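(* Let $X$ be a complex manifold of dimension $n$, with $p\in X$, local coordinates $u_1,\dots,u_n$ at $p$, coordinate neighborhood $U$ and weight vector $\gamma\in\mathbb{N}^n$, and let $\mathcal{X}$ and $\pi:\mathcal{X}\to\mathbb{C}$ be the space and map constructed from these data by gluing $X\times\mathbb{C}^*$ and $\tilde U$ along $\tilde\phi$. Then: (1) $\mathcal{X}$ has the structure of a complex manifold. (2) The map $\pi:\mathcal{X}\to\mathbb{C}$ is holomorphic. (3) The map $\pi$ has no critical points.
   Context: $\mathbb{N}$ denotes the positive integers and $\mathbb{C}^*=\mathbb{C}\setminus\{0\}$. Let $X$ be a complex manifold of dimension $n$, $p\in X$, and $u_1,\dots,u_n$ local coordinates at $p$ with $u_i(p)=0$. Let $U\subset X$ be open with $p\in U$ such that $\phi=(u_1,\dots,u_n):U\to\mathbb{C}^n$ is a biholomorphism onto an open subset $\phi(U)\ni0$ of $\mathbb{C}^n$. Fix $\gamma=(\gamma_1,\dots,\gamma_n)\in\mathbb{N}^n$. Define $$\tilde\phi:U\times\mathbb{C}^*\to\mathbb{C}^{n+1},\qquad \tilde\phi(x,t)=(t^{-\gamma_1}u_1(x),\dots,t^{-\gamma_n}u_n(x),t),$$ $$\tilde U=\tilde\phi(U\times\mathbb{C}^* )\cup((\mathbb{C}^* )^n\times\{0\})\subset\mathbb{C}^{n+1},$$ which is an open subset of $\mathbb{C}^{n+1}$; $\tilde\phi$ is a biholomorphism onto its (open) image. Let $\mathcal{X}=((X\times\mathbb{C}^* )\amalg\tilde U)/\sim$, with the quotient topology,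 where $(x,t)\in U\times\mathbb{C}^*$ is identified with $\tilde\phi(x,t)\in\tilde U$; the complex structure is the one glued from those of $X\times\mathbb{C}^*$ and $\tilde U$. Define $\pi:\mathcal{X}\to\mathbb{C}$ by $\pi(x,t)=t$ on $X\times\mathbb{C}^*$ and $\pi(\tilde u,t)=t$ on $\tilde U\subset\mathbb{C}^n\times\mathbb{C}$. *)

theory Defs
  imports "HOL-Analysis.Analysis"
begin

section \<open>Complex manifolds\<close>

text \<open>Complex differentiability in several variables: the real Frechet derivative exists at every
  point and is complex linear.  Used below only for open sets \<^term>\<open>S\<close>.\<close>

definition holo_on :: "(complex^'m \<Rightarrow> complex^'k) \<Rightarrow> (complex^'m) set \<Rightarrow> bool" where
  "holo_on f S \<longleftrightarrow>
     (\<forall>z\<in>S. \<exists>D. (f has_derivative D) (at z) \<and> Vector_Spaces.linear (*s) (*s) D)"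

text \<open>A chart is a pair of a domain and a map; only the values of the map on the domain matter.\<close>

type_synonym ('a, 'm) chart = "'a set \<times> ('a \<Rightarrow> complex^'m)"

record ('a, 'm) charted_space =
  mtop :: "'a topology"
  charts :: "('a, 'm::finite) chart set"

abbreviation points :: "('a, 'm::finite) charted_space \<Rightarrow> 'a set" where
  "points M \<equiv> topspace (mtop M)"

definition is_chart :: "'a topology \<Rightarrow> ('a, 'm::finite) chart \<Rightarrow> bool" where
  "is_chart T = (\<lambda>(V, \<psi>). openin T V \<and> open (\<psi> ` V) \<and>
     homeomorphic_map (subtopology T V) (top_of_set (\<psi> ` V)) \<psi>)"

definition holo_transition :: "('a, 'm::finite) chart \<Rightarrow> ('a, 'm) chart \<Rightarrow> bool" where
  "holo_transition = (\<lambda>(V, \<psi>) (W, \<theta>). holo_on (\<theta> \<circ> inv_into V \<psi>) (\<psi> ` (V \<inter> W)))"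

text \<open>A complex manifold of dimension \<^term>\<open>CARD('m)\<close>, given by a not necessarily maximal atlas.
  All ordered pairs of charts are considered, so that transition maps are biholomorphic.\<close>

definition complex_manifold :: "('a, 'm::finite) charted_space \<Rightarrow> bool" where
  "complex_manifold M \<longleftrightarrow>
     Hausdorff_space (mtop M) \<and> second_countable (mtop M) \<and>
     (\<forall>c\<in>charts M. is_chart (mtop M) c) \<and>
     (\<Union>c\<in>charts M. fst c) = points M \<and>
     (\<forall>c\<in>charts M. \<forall>d\<in>charts M. holo_transition c d)"

definition holo_map ::
  "('a, 'm::finite) charted_space \<Rightarrow> ('b, 'k::finite) charted_space \<Rightarrow> ('a \<Rightarrow> 'b) \<Rightarrow> bool" where
  "holo_map M N f \<longleftrightarrow> continuous_map (mtop M) (mtop N) f \<and>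
     (\<forall>(V, \<psi>)\<in>charts M. \<forall>(W, \<theta>)\<in>charts N.
        holo_on (\<theta> \<circ> f \<circ> inv_into V \<psi>) (\<psi> ` (V \<inter> f -` W)))"

definition biholo_map ::
  "('a, 'm::finite) charted_space \<Rightarrow> ('b, 'k::finite) charted_space \<Rightarrow> ('a \<Rightarrow> 'b) \<Rightarrow> bool" where
  "biholo_map M N f \<longleftrightarrow> bij_betw f (points M) (points N) \<and>
     holo_map M N f \<and> holo_map N M (inv_into (points M) f)"

text \<open>A critical point of a holomorphic map is a point where the differential, read in charts,
  is not surjective.\<close>

definition critical_point ::
  "('a, 'm::finite) charted_space \<Rightarrow> ('b, 'k::finite) charted_space \<Rightarrow> ('a \<Rightarrow> 'b) \<Rightarrow> 'a \<Rightarrow> bool" where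
  "critical_point M N f x \<longleftrightarrow> x \<in> points M \<and>
     (\<exists>(V, \<psi>)\<in>charts M. \<exists>(W, \<theta>)\<in>charts N. x \<in> V \<and> f x \<in> W \<and>
        (\<exists>D. ((\<theta> \<circ> f \<circ> inv_into V \<psi>) has_derivative D) (at (\<psi> x)) \<and> \<not> surj D))"

definition open_submanifold ::
  "('a, 'm::finite) charted_space \<Rightarrow> 'a set \<Rightarrow> ('a, 'm) charted_space" where
  "open_submanifold M U =
     \<lparr> mtop = subtopology (mtop M) U, charts = (\<lambda>(V, \<psi>). (V \<inter> U, \<psi>)) ` charts M \<rparr>"

definition open_subset_manifold :: "(complex^'m) set \<Rightarrow> (complex^'m, 'm::finite) charted_space" where
  "open_subset_manifold S = \<lparr> mtop = top_of_set S, charts = {(S, id)} \<rparr>"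

definition complex_plane :: "(complex, 1) charted_space" where
  "complex_plane = \<lparr> mtop = euclidean, charts = {(UNIV, vec)} \<rparr>"


section \<open>Gluing\<close>

definition coproduct_topology :: "'a topology \<Rightarrow> 'b topology \<Rightarrow> ('a + 'b) topology" where
  "coproduct_topology X Y = topology (\<lambda>W. W \<subseteq> topspace X <+> topspace Y \<and>
     openin X (Inl -` W) \<and> openin Y (Inr -` W))"

text \<open>For an equivalence relation on the underlying set of the topology.\<close>

definition quotient_topology :: "'a topology \<Rightarrow> ('a \<times> 'a) set \<Rightarrow> 'a set topology" where
  "quotient_topology X r = topology (\<lambda>W. W \<subseteq> topspace X // r \<and>
     openin X {x \<in> topspace X. r `` {x} \<in> W})"

lemma openin_coproduct_topology:
  "openin (coproduct_topology X Y) W \<longleftrightarrow>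
     W \<subseteq> topspace X <+> topspace Y \<and> openin X (Inl -` W) \<and> openin Y (Inr -` W)"
proof -
  have "istopology (\<lambda>W. W \<subseteq> topspace X <+> topspace Y \<and> openin X (Inl -` W) \<and> openin Y (Inr -` W))"
    by (auto simp: istopology_def vimage_Union)
  then show ?thesis
    by (simp add: coproduct_topology_def)
qed

lemma topspace_coproduct_topology [simp]:
  "topspace (coproduct_topology X Y) = topspace X <+> topspace Y"
proof (rule antisym)
  show "topspace (coproduct_topology X Y) \<subseteq> topspace X <+> topspace Y"
    by (meson openin_coproduct_topology openin_topspace)
  have "Inl -` (topspace X <+> topspace Y) = topspace X" "Inr -` (topspace X <+> topspace Y) = topspace Y"
    by auto
  then have "openin (coproduct_topology X Y) (topspace X <+> topspace Y)"
    by (simp add: openin_coproduct_topology)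
  then show "topspace X <+> topspace Y \<subseteq> topspace (coproduct_topology X Y)"
    by (rule openin_subset)
qed

lemma openin_quotient_topology:
  "openin (quotient_topology X r) W \<longleftrightarrow>
     W \<subseteq> topspace X // r \<and> openin X {x \<in> topspace X. r `` {x} \<in> W}"
proof -
  let ?L = "\<lambda>W. W \<subseteq> topspace X // r \<and> openin X {x \<in> topspace X. r `` {x} \<in> W}"
  have "?L (S \<inter> T)" if "?L S" "?L T" for S T
  proof -
    have "{x \<in> topspace X. r `` {x} \<in> S \<inter> T} =
        {x \<in> topspace X. r `` {x} \<in> S} \<inter> {x \<in> topspace X. r `` {x} \<in> T}"
      by auto
    with that show ?thesis by auto
  qed
  moreover have "?L (\<Union>\<K>)" if "\<forall>K\<in>\<K>. ?L K" for \<K>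
  proof -
    have "{x \<in> topspace X. r `` {x} \<in> \<Union>\<K>} = (\<Union>K\<in>\<K>. {x \<in> topspace X. r `` {x} \<in> K})"
      by auto
    with that show ?thesis by auto
  qed
  ultimately have "istopology ?L"
    unfolding istopology_def by blast
  then show ?thesis
    by (simp add: quotient_topology_def)
qed

lemma topspace_quotient_topology [simp]:
  "topspace (quotient_topology X r) = topspace X // r"
proof (rule antisym)
  show "topspace (quotient_topology X r) \<subseteq> topspace X // r"
    by (meson openin_quotient_topology openin_topspace)
  have "{x \<in> topspace X. r `` {x} \<in> topspace X // r} = topspace X"
    by (auto intro: quotientI)
  then have "openin (quotient_topology X r) (topspace X // r)"
    by (simp add: openin_quotient_topology)
  then show "topspace X // r \<subseteq> topspace (quotient_topology X r)"
    by (rule openin_subset)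
qed

text \<open>The equivalence relation on the disjoint union of \<^term>\<open>A\<close> and \<^term>\<open>B\<close> generated by
  identifying \<^term>\<open>a\<close> with \<^term>\<open>b\<close> for all \<^term>\<open>(a, b) \<in> R\<close>.\<close>

definition glue_rel :: "'a set \<Rightarrow> 'b set \<Rightarrow> ('a \<times> 'b) set \<Rightarrow> (('a + 'b) \<times> ('a + 'b)) set" where
  "glue_rel A B R =
     (let E = {(Inl a, Inr b) | a b. (a, b) \<in> R}
      in (E \<union> E\<inverse>)\<^sup>* \<inter> (A <+> B) \<times> (A <+> B))"

lemma equiv_glue_rel: "equiv (A <+> B) (glue_rel A B R)"
proof -
  define E :: "(('a + 'b) \<times> ('a + 'b)) set" where "E = {(Inl a, Inr b) | a b. (a, b) \<in> R}"
  have "sym ((E \<union> E\<inverse>)\<^sup>*)"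
    by (intro sym_rtrancl sym_Un_converse)
  then show ?thesis
    unfolding glue_rel_def Let_def E_def[symmetric]
    by (intro equivI refl_onI symI transI) (auto dest: symD intro: rtrancl_trans)
qed

text \<open>Transport of a chart along an injection \<^term>\<open>j\<close> of a space with underlying set \<^term>\<open>A\<close>.\<close>

definition push_chart :: "'a set \<Rightarrow> ('a \<Rightarrow> 'b) \<Rightarrow> ('a, 'm::finite) chart \<Rightarrow> ('b, 'm) chart" where
  "push_chart A j = (\<lambda>(V, \<psi>). (j ` V, \<psi> \<circ> inv_into A j))"

text \<open>The quotient of the disjoint union by \<^const>\<open>glue_rel\<close>, with the charts of both pieces.\<close>

definition glue ::
  "('a, 'm::finite) charted_space \<Rightarrow> ('b, 'm) charted_space \<Rightarrow> ('a \<times> 'b) set \<Rightarrow>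
     (('a + 'b) set, 'm) charted_space" where
  "glue M N R =
     (let r = glue_rel (points M) (points N) R
      in \<lparr> mtop = quotient_topology (coproduct_topology (mtop M) (mtop N)) r,
           charts = push_chart (points M) (\<lambda>a. r `` {Inl a}) ` charts M \<union>
                    push_chart (points N) (\<lambda>b. r `` {Inr b}) ` charts N \<rparr>)"


section \<open>The deformation space\<close>

text \<open>The space \<open>\<complex>\<^sup>n\<^sup>+\<^sup>1 = \<complex>\<^sup>n \<times> \<complex>\<close> is modelled on the index type \<^typ>\<open>'n option\<close>, where the index
  \<^term>\<open>None\<close> stands for the last coordinate.\<close>

definition join :: "complex^'n \<Rightarrow> complex \<Rightarrow> complex^('n::finite option)" where
  "join z t = (\<chi> j. case j of None \<Rightarrow> t | Some i \<Rightarrow> z $ i)"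

definition times_Cstar ::
  "('a, 'n::finite) charted_space \<Rightarrow> ('a \<times> complex, 'n option) charted_space" where
  "times_Cstar X =
     \<lparr> mtop = prod_topology (mtop X) (top_of_set (- {0})),
       charts = (\<lambda>(V, \<psi>). (V \<times> (- {0}), \<lambda>(x, t). join (\<psi> x) t)) ` charts X \<rparr>"

definition phi_tilde ::
  "nat^'n \<Rightarrow> ('a \<Rightarrow> complex^'n) \<Rightarrow> 'a \<times> complex \<Rightarrow> complex^('n::finite option)" where
  "phi_tilde \<gamma> \<phi> = (\<lambda>(x, t). join (\<chi> i. t powi (- int (\<gamma> $ i)) * \<phi> x $ i) t)"

definition U_tilde ::
  "nat^'n \<Rightarrow> 'a set \<Rightarrow> ('a \<Rightarrow> complex^'n) \<Rightarrow> (complex^('n::finite option)) set" where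
  "U_tilde \<gamma> U \<phi> = phi_tilde \<gamma> \<phi> ` (U \<times> (- {0})) \<union> {join z 0 | z. \<forall>i. z $ i \<noteq> 0}"

definition deformation ::
  "('a, 'n::finite) charted_space \<Rightarrow> nat^'n \<Rightarrow> 'a set \<Rightarrow> ('a \<Rightarrow> complex^'n) \<Rightarrow>
     (('a \<times> complex + complex^('n option)) set, 'n option) charted_space" where
  "deformation X \<gamma> U \<phi> =
     glue (times_Cstar X) (open_subset_manifold (U_tilde \<gamma> U \<phi>))
       {(y, phi_tilde \<gamma> \<phi> y) | y. y \<in> U \<times> (- {0})}"

text \<open>The map induced on equivalence classes; it is constant on each class of
  \<^const>\<open>deformation\<close>.\<close>

definition deformation_pi :: "('a \<times> complex + complex^('n::finite option)) set \<Rightarrow> complex" where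
  "deformation_pi c = the_elem (case_sum snd (\<lambda>w. w $ None) ` c)"

end

theory Submission
  imports Defs
begin

text \<open>
  Two facts carry the theorem: a general criterion for a glued space to be a manifold, and the
  observation that \<open>\<pi>\<close> is a coordinate function in every chart.

  Gluing two manifolds \<open>M\<close> and \<open>N\<close> along a biholomorphism \<open>f\<close> from an open \<open>D \<subseteq> M\<close> onto an open
  subset of \<open>N\<close> embeds both pieces as open subsets that cover the quotient.  Local properties
  (charts, holomorphic transitions, second countability) are then inherited from the pieces.  Only the
  Hausdorff axiom is global; the pairs of points that neither piece separates are those \<open>(a, b)\<close>
  with \<open>a \<notin> D\<close> and \<open>b \<notin> f ` D\<close>, and for these a separation hypothesis is made in the
  locale \<open>gluing\<close>, whose outcome is \<open>complex_manifold_glue\<close>.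

  Here \<open>M = X \<times> \<complex>\<^sup>*\<close>, \<open>N\<close> is the set \<open>U_tilde\<close> and \<open>f\<close> is \<open>phi_tilde\<close>.  The latter is \<open>\<phi> \<times> id\<close> followed by
  the scaling of the \<open>i\<close>-th coordinate by the \<open>-\<gamma>\<^sub>i\<close>-th power of the last coordinate \<open>t\<close>, which is inverted
  by the scaling with opposite weights as long as \<open>t \<noteq> 0\<close>.  The scaling with weights \<open>\<gamma>\<close> is defined and continuous
  on all of \<open>\<complex>\<^sup>n\<^sup>+\<^sup>1\<close> and kills the first \<open>n\<close> coordinates at \<open>t = 0\<close>, where \<open>0 \<in> \<phi> ` U\<close>; this
  exhibits \<open>U_tilde\<close> as the intersection of two open conditions (\<open>C_eq\<close>).  Points outside the
  gluing region have \<open>t \<noteq> 0\<close> in the first piece and \<open>t = 0\<close> in the second, and \<open>f\<close> preserves \<open>t\<close>, so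
  \<open>\<bar>t\<bar>\<close> separates them.

  Finally, every chart of the glued space has \<open>\<pi>\<close> as its last coordinate (\<open>pi_in_charts\<close>), so \<open>\<pi>\<close> is
  holomorphic with surjective differential everywhere.
\<close>

section \<open>Holomorphic maps between coordinate spaces\<close>

lemma holo_on_cong_open:
  assumes "open S" "holo_on f S" "\<And>z. z \<in> S \<Longrightarrow> f z = g z"
  shows "holo_on g S"
  unfolding holo_on_def
proof
  fix z assume z: "z \<in> S"
  then obtain D where D: "(f has_derivative D) (at z)" "Vector_Spaces.linear (*s) (*s) D"
    using assms(2) by (auto simp: holo_on_def)
  have "(g has_derivative D) (at z)"
    by (rule has_derivative_transform_within_open[OF D(1) assms(1) z]) (use assms(3) in auto)
  with D(2) show "\<exists>D. (g has_derivative D) (at z) \<and> Vector_Spaces.linear (*s) (*s) D"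
    by blast
qed

lemma holo_on_subset: "holo_on f S \<Longrightarrow> T \<subseteq> S \<Longrightarrow> holo_on f T"
  by (auto simp: holo_on_def)

lemma holo_on_compose:
  assumes "holo_on f S" "holo_on g T" "f ` S \<subseteq> T"
  shows "holo_on (g \<circ> f) S"
  unfolding holo_on_def
proof
  fix z assume z: "z \<in> S"
  then obtain D where D: "(f has_derivative D) (at z)" "Vector_Spaces.linear (*s) (*s) D"
    using assms(1) by (auto simp: holo_on_def)
  obtain E where E: "(g has_derivative E) (at (f z))" "Vector_Spaces.linear (*s) (*s) E"
    using assms(2,3) z by (auto simp: holo_on_def)
  have "((g \<circ> f) has_derivative (E \<circ> D)) (at z)"
    using D(1) E(1) by (rule diff_chain_at)
  moreover have "Vector_Spaces.linear (*s) (*s) (E \<circ> D)"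
    using D(2) E(2) by (rule Vector_Spaces.linear_compose)
  ultimately show "\<exists>D. ((g \<circ> f) has_derivative D) (at z) \<and> Vector_Spaces.linear (*s) (*s) D"
    by blast
qed

lemma holo_on_id: "holo_on id S"
  unfolding holo_on_def
  using has_derivative_id vec.linear_id by blast

lemma linear_vecI:
  fixes D :: "complex^'m \<Rightarrow> complex^'k"
  assumes "\<And>x y. D (x + y) = D x + D y" "\<And>c x. D (c *s x) = c *s D x"
  shows "Vector_Spaces.linear (*s) (*s) D"
  using assms by (unfold_locales) (auto simp: vector_add_ldistrib vector_sadd_rdistrib)

lemma has_derivative_vec:
  fixes f :: "complex^'m \<Rightarrow> complex^'k"
  assumes "\<And>k. ((\<lambda>w. f w $ k) has_derivative D k) (at z)"
  shows "(f has_derivative (\<lambda>h. \<chi> k. D k h)) (at z)"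
proof -
  have eq: "(\<chi> k. g k) = (\<Sum>k\<in>UNIV. axis k (g k))" for g :: "'k \<Rightarrow> complex"
    by (simp add: vec_eq_iff axis_def if_distrib cong: if_cong)
  have bl: "bounded_linear (axis k :: complex \<Rightarrow> complex^'k)" for k
    unfolding linear_conv_bounded_linear[symmetric]
    by (auto intro!: linearI simp: axis_def vec_eq_iff)
  have "((\<lambda>w. \<Sum>k\<in>UNIV. axis k (f w $ k)) has_derivative (\<lambda>h. \<Sum>k\<in>UNIV. axis k (D k h))) (at z)"
    by (intro has_derivative_sum bounded_linear.has_derivative[OF bl] assms)
  then show ?thesis
    by (simp flip: eq)
qed

lemma holo_on_componentwise:
  fixes f :: "complex^'m \<Rightarrow> complex^'k"
  assumes "\<And>k z. z \<in> S \<Longrightarrow>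
    \<exists>D. ((\<lambda>w. f w $ k) has_derivative D) (at z) \<and> (\<forall>c h. D (c *s h) = c * D h)"
  shows "holo_on f S"
  unfolding holo_on_def
proof
  fix z assume "z \<in> S"
  then obtain D where D: "\<And>k. ((\<lambda>w. f w $ k) has_derivative D k) (at z)"
      "\<And>k c h. D k (c *s h) = c * D k h"
    using assms by metis
  have "Vector_Spaces.linear (*s) (*s) (\<lambda>h. \<chi> k. D k h)"
    by (rule linear_vecI) (simp_all add: vec_eq_iff D(2) linear_add[OF has_derivative_linear[OF D(1)]])
  with has_derivative_vec[of f, OF D(1)]
  show "\<exists>D. (f has_derivative D) (at z) \<and> Vector_Spaces.linear (*s) (*s) D"
    by blast
qed

section \<open>Charts\<close>

text \<open>A form without the subspace topology on the image: openness of the image and continuity of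
  the inverse amount to openness of the map, which is what has to be checked when charts are
  transported, restricted or multiplied.\<close>

lemma is_chart_iff:
  "is_chart T (V, \<psi>) \<longleftrightarrow> openin T V \<and> inj_on \<psi> V \<and>
     continuous_map (subtopology T V) euclidean \<psi> \<and>
     (\<forall>S. openin T S \<and> S \<subseteq> V \<longrightarrow> open (\<psi> ` S))"
proof (cases "openin T V")
  case True
  then have top: "topspace (subtopology T V) = V"
    by (simp add: inf.absorb2 openin_subset)
  have "homeomorphic_map (subtopology T V) (top_of_set (\<psi> ` V)) \<psi> \<longleftrightarrow>
      continuous_map (subtopology T V) euclidean \<psi> \<and>
      (\<forall>S. openin T S \<and> S \<subseteq> V \<longrightarrow> open (\<psi> ` S)) \<and> inj_on \<psi> V"
    if op: "open (\<psi> ` V)"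
  proof -
    have om: "open_map (subtopology T V) (top_of_set (\<psi> ` V)) \<psi> \<longleftrightarrow>
        (\<forall>S. openin T S \<and> S \<subseteq> V \<longrightarrow> open (\<psi> ` S))"
      using op True by (auto simp: open_map_def openin_open_subtopology openin_open_eq)
    have "homeomorphic_map (subtopology T V) (top_of_set (\<psi> ` V)) \<psi> \<longleftrightarrow>
        continuous_map (subtopology T V) (top_of_set (\<psi> ` V)) \<psi> \<and>
        open_map (subtopology T V) (top_of_set (\<psi> ` V)) \<psi> \<and> inj_on \<psi> V"
      using bijective_open_imp_homeomorphic_map[of "subtopology T V" "top_of_set (\<psi> ` V)" \<psi>] top
      by (auto simp: homeomorphic_eq_everything_map)
    then show ?thesis
      unfolding om using top by (auto simp: continuous_map_in_subtopology)
  qed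
  moreover have "openin T V \<and> V \<subseteq> V" using True by simp
  ultimately show ?thesis
    unfolding is_chart_def by blast
qed (auto simp: is_chart_def)

lemma is_chart_image_open:
  assumes "is_chart T (V, \<psi>)" "openin T S"
  shows "open (\<psi> ` (V \<inter> S))"
proof -
  have "openin T (V \<inter> S)" "V \<inter> S \<subseteq> V"
    using assms by (auto simp: is_chart_iff)
  with assms(1) show ?thesis
    unfolding is_chart_iff by blast
qed

lemma is_chart_restrict:
  assumes "is_chart T (V, \<psi>)" "openin T U"
  shows "is_chart (subtopology T U) (V \<inter> U, \<psi>)"
proof -
  have V: "openin T V" using assms(1) by (simp add: is_chart_iff)
  have *: "continuous_map (subtopology T (U \<inter> (V \<inter> U))) euclidean \<psi>"
    using assms(1) unfolding is_chart_iff
    by (metis Int_left_absorb Int_commute continuous_map_from_subtopology subtopology_subtopology)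
  then show ?thesis
    using assms V
    by (auto simp: is_chart_iff subtopology_subtopology openin_open_subtopology intro: inj_on_subset)
qed

lemma is_chart_vimage_open:
  assumes "is_chart T (V, \<psi>)" "open O'"
  shows "openin T {x \<in> V. \<psi> x \<in> O'}"
proof -
  have V: "openin T V" and c: "continuous_map (subtopology T V) euclidean \<psi>"
    using assms(1) by (auto simp: is_chart_iff)
  have "openin (subtopology T V) {x \<in> topspace (subtopology T V). \<psi> x \<in> O'}"
    by (rule openin_continuous_map_preimage[OF c]) (simp add: assms(2))
  moreover have "topspace (subtopology T V) = V"
    using V by (simp add: inf.absorb2 openin_subset)
  ultimately have "openin (subtopology T V) {x \<in> V. \<psi> x \<in> O'}"
    by (simp only:)
  then show ?thesis
    using V by (simp only: openin_open_subtopology)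
qed

text \<open>The coordinate expression of a map involves a choice of inverse of the chart.
  Since it is only evaluated on the open image of the chart, any holomorphic function with the right
  values there may replace it.\<close>

lemma holo_mapI:
  fixes M :: "('a, 'm::finite) charted_space" and N :: "('b, 'k::finite) charted_space"
  assumes M: "\<And>c. c \<in> charts M \<Longrightarrow> is_chart (mtop M) c"
    and N: "\<And>W \<theta>. (W, \<theta>) \<in> charts N \<Longrightarrow> openin (mtop N) W"
    and f: "continuous_map (mtop M) (mtop N) f"
    and h: "\<And>V \<psi> W \<theta>. (V, \<psi>) \<in> charts M \<Longrightarrow> (W, \<theta>) \<in> charts N \<Longrightarrow>
      \<exists>h. holo_on h (\<psi> ` (V \<inter> f -` W)) \<and> (\<forall>v \<in> V \<inter> f -` W. h (\<psi> v) = \<theta> (f v))"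
  shows "holo_map M N f"
proof -
  have "holo_on (\<theta> \<circ> f \<circ> inv_into V \<psi>) (\<psi> ` (V \<inter> f -` W))"
    if c: "(V, \<psi>) \<in> charts M" and d: "(W, \<theta>) \<in> charts N" for V \<psi> W \<theta>
  proof -
    have chart: "is_chart (mtop M) (V, \<psi>)" by (rule M[OF c])
    then have "V \<subseteq> points M" and inj: "inj_on \<psi> V"
      by (auto simp: is_chart_iff dest: openin_subset)
    then have "V \<inter> f -` W = V \<inter> {x \<in> points M. f x \<in> W}" by auto
    moreover have "openin (mtop M) {x \<in> points M. f x \<in> W}"
      using f N[OF d] by (rule openin_continuous_map_preimage)
    ultimately have op: "open (\<psi> ` (V \<inter> f -` W))"
      using is_chart_image_open[OF chart] by simp
    obtain h where "holo_on h (\<psi> ` (V \<inter> f -` W))" "\<forall>v \<in> V \<inter> f -` W. h (\<psi> v) = \<theta> (f v)"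
      using h[OF c d] by blast
    then show ?thesis
      by (elim holo_on_cong_open[OF op]) (use inj in force)
  qed
  with f show ?thesis
    unfolding holo_map_def by blast
qed

text \<open>An open embedding is a homeomorphism onto an open subset, so it carries charts to charts.\<close>

lemma is_chart_push_chart:
  fixes \<psi> :: "'a \<Rightarrow> complex^'m::finite"
  assumes i: "continuous_map T G i" "open_map T G i" "inj_on i (topspace T)"
    and c: "is_chart T (V, \<psi>)"
  shows "is_chart G (push_chart (topspace T) i (V, \<psi>))"
proof -
  let ?A = "topspace T"
  have V: "openin T V" and inj: "inj_on \<psi> V"
    and op: "\<And>S. openin T S \<Longrightarrow> S \<subseteq> V \<Longrightarrow> open (\<psi> ` S)"
    using c by (auto simp: is_chart_iff)
  have VA: "V \<subseteq> ?A" using V by (rule openin_subset)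
  have iV: "openin G (i ` V)" using i(2) V by (simp add: open_map_def)
  have inv: "inv_into ?A i (i v) = v" if "v \<in> V" for v
    using i(3) that VA by (simp add: inv_into_f_f subset_iff)
  have inj': "inj_on (\<psi> \<circ> inv_into ?A i) (i ` V)"
    using inj by (auto simp: inj_on_def inv)
  have top: "topspace (subtopology G (i ` V)) = i ` V"
    using iV by (simp add: inf.absorb2 openin_subset)
  have cont: "continuous_map (subtopology G (i ` V)) euclidean (\<psi> \<circ> inv_into ?A i)"
  proof (unfold continuous_map_def top, intro conjI allI impI)
    show "\<psi> \<circ> inv_into ?A i \<in> i ` V \<rightarrow> topspace euclidean" by simp
    fix O' :: "(complex^'m) set" assume "openin euclidean O'"
    then have *: "openin T {v \<in> V. \<psi> v \<in> O'}"
      using is_chart_vimage_open[OF c] by simp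
    have eq: "{x \<in> i ` V. (\<psi> \<circ> inv_into ?A i) x \<in> O'} = i ` {v \<in> V. \<psi> v \<in> O'}"
      by (auto simp: inv)
    have "openin G (i ` {v \<in> V. \<psi> v \<in> O'})"
      using * i(2) unfolding open_map_def by blast
    then show "openin (subtopology G (i ` V)) {x \<in> i ` V. (\<psi> \<circ> inv_into ?A i) x \<in> O'}"
      using iV unfolding eq by (auto simp: openin_open_subtopology)
  qed
  have opn: "open ((\<psi> \<circ> inv_into ?A i) ` S)" if S: "openin G S" "S \<subseteq> i ` V" for S
  proof -
    let ?S = "V \<inter> {a \<in> ?A. i a \<in> S}"
    have "openin T ?S"
      by (intro openin_Int V openin_continuous_map_preimage[OF i(1)] S)
    then have "open (\<psi> ` ?S)"
      by (rule op) simp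
    moreover have "(\<psi> \<circ> inv_into ?A i) ` S = \<psi> ` ?S"
    proof -
      have "S = i ` ?S" using S(2) VA by auto
      then have "(\<psi> \<circ> inv_into ?A i) ` S = (\<psi> \<circ> inv_into ?A i) ` i ` ?S" by (rule arg_cong)
      also have "\<dots> = \<psi> ` ?S"
        unfolding image_comp by (rule image_cong) (auto simp: inv)
      finally show ?thesis .
    qed
    ultimately show ?thesis by simp
  qed
  show ?thesis
    unfolding push_chart_def prod.case is_chart_iff
    using iV inj' cont opn by blast
qed

text \<open>The two pushed charts meet where \<open>i v = k (g v)\<close>; there the transition map reads \<open>g\<close> in the
  original charts.  With \<open>g\<close> the identity, the gluing map or its inverse this covers all pairs of
  charts of a glued space.\<close>

lemma holo_transition_push_chart:
  fixes \<psi> :: "'a \<Rightarrow> complex^'m::finite" and \<theta> :: "'b \<Rightarrow> complex^'m"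
  assumes i: "inj_on i A" and k: "inj_on k B"
    and V: "V \<subseteq> A" "inj_on \<psi> V" and W: "W \<subseteq> B"
    and P: "P \<subseteq> V" "\<And>v. v \<in> P \<Longrightarrow> g v \<in> W \<and> i v = k (g v)"
      "\<And>v. v \<in> V \<Longrightarrow> i v \<in> k ` W \<Longrightarrow> v \<in> P"
    and op: "open (\<psi> ` P)"
    and h: "holo_on h (\<psi> ` P)" "\<And>v. v \<in> P \<Longrightarrow> h (\<psi> v) = \<theta> (g v)"
  shows "holo_transition (push_chart A i (V, \<psi>)) (push_chart B k (W, \<theta>))"
proof -
  have inv: "inv_into A i (i v) = v" if "v \<in> V" for v
    using i that V(1) by (simp add: inv_into_f_f subset_iff)
  have invk: "inv_into B k (k w) = w" if "w \<in> W" for w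
    using k that W by (simp add: inv_into_f_f subset_iff)
  have inj: "inj_on (\<psi> \<circ> inv_into A i) (i ` V)"
    using V(2) by (auto simp: inj_on_def inv)
  have set: "i ` V \<inter> k ` W = i ` P"
  proof
    show "i ` V \<inter> k ` W \<subseteq> i ` P" using P(3) by blast
    show "i ` P \<subseteq> i ` V \<inter> k ` W"
    proof
      fix x assume "x \<in> i ` P"
      then obtain v where v: "v \<in> P" "x = i v" by blast
      then show "x \<in> i ` V \<inter> k ` W" using P(1) P(2)[OF v(1)] by blast
    qed
  qed
  have im: "(\<psi> \<circ> inv_into A i) ` i ` P = \<psi> ` P"
    unfolding image_comp by (rule image_cong) (use P(1) in \<open>auto simp: inv\<close>)
  have val: "(\<theta> \<circ> inv_into B k \<circ> inv_into (i ` V) (\<psi> \<circ> inv_into A i)) (\<psi> v) = \<theta> (g v)"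
    if "v \<in> P" for v
  proof -
    have "inv_into (i ` V) (\<psi> \<circ> inv_into A i) (\<psi> v) = i v"
      by (rule inv_into_f_eq[OF inj]) (use that P(1) in \<open>auto simp: inv\<close>)
    then show ?thesis
      using P(2)[OF that] invk by simp
  qed
  have "holo_on (\<theta> \<circ> inv_into B k \<circ> inv_into (i ` V) (\<psi> \<circ> inv_into A i)) (\<psi> ` P)"
    by (rule holo_on_cong_open[OF op h(1)]) (use val h(2) in auto)
  then show ?thesis
    unfolding holo_transition_def push_chart_def prod.case set im .
qed

section \<open>Gluing along a biholomorphism of open subsets\<close>

locale gluing =
  fixes M :: "('a, 'm::finite) charted_space" and N :: "('b, 'm) charted_space"
    and D :: "'a set" and f :: "'a \<Rightarrow> 'b"
  assumes M: "complex_manifold M" and N: "complex_manifold N"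
    and D: "openin (mtop M) D" and fD: "openin (mtop N) (f ` D)"
    and biholo: "biholo_map (open_submanifold M D) (open_submanifold N (f ` D)) f"
    and separated: "\<And>a b. a \<in> points M - D \<Longrightarrow> b \<in> points N - f ` D \<Longrightarrow>
      \<exists>P Q. openin (mtop M) P \<and> openin (mtop N) Q \<and> a \<in> P \<and> b \<in> Q \<and> f ` (P \<inter> D) \<inter> Q = {}"
begin

abbreviation "R \<equiv> {(a, f a) | a. a \<in> D}"
abbreviation "r \<equiv> glue_rel (points M) (points N) R"
abbreviation "G \<equiv> glue M N R"

definition i where "i a = r `` {Inl a}"
definition j where "j b = r `` {Inr b}"

lemma D_sub: "D \<subseteq> points M" and fD_sub: "f ` D \<subseteq> points N"
  using D fD by (auto dest: openin_subset)

lemma points_D: "points (open_submanifold M D) = D"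
  and points_fD: "points (open_submanifold N (f ` D)) = f ` D"
  using D_sub fD_sub by (auto simp: open_submanifold_def)

lemma inj_f: "inj_on f D"
  using biholo points_D by (simp add: biholo_map_def bij_betw_def)

lemma holo_f: "holo_map (open_submanifold M D) (open_submanifold N (f ` D)) f"
  and holo_inv_f: "holo_map (open_submanifold N (f ` D)) (open_submanifold M D) (inv_into D f)"
  using biholo unfolding biholo_map_def points_D by auto

text \<open>The gluing map is injective, so no chain of identifications is longer than one step: the
  generated equivalence relation has classes with at most two elements.\<close>

lemma glue_rel_eq:
  "r = (Id \<union> {(Inl a, Inr (f a)) | a. a \<in> D} \<union> {(Inr (f a), Inl a) | a. a \<in> D})
     \<inter> (points M <+> points N) \<times> (points M <+> points N)"
proof -
  define E :: "(('a + 'b) \<times> ('a + 'b)) set" where "E = {(Inl a, Inr b) | a b. (a, b) \<in> R}"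
  have "(E \<union> E\<inverse>)\<^sup>* = Id \<union> E \<union> E\<inverse>"
  proof
    show "(E \<union> E\<inverse>)\<^sup>* \<subseteq> Id \<union> E \<union> E\<inverse>"
    proof (rule subrelI)
      fix x y assume "(x, y) \<in> (E \<union> E\<inverse>)\<^sup>*"
      then show "(x, y) \<in> Id \<union> E \<union> E\<inverse>"
        by (induction rule: rtrancl_induct) (auto simp: E_def dest: inj_onD[OF inj_f])
    qed
  qed auto
  moreover have "E = {(Inl a, Inr (f a)) | a. a \<in> D}" "E\<inverse> = {(Inr (f a), Inl a) | a. a \<in> D}"
    by (auto simp: E_def)
  ultimately show ?thesis
    unfolding glue_rel_def Let_def E_def[symmetric] by simp
qed

lemma i_eq: "a \<in> points M \<Longrightarrow> i a = insert (Inl a) (Inr ` f ` ({a} \<inter> D))"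
  using fD_sub D_sub by (auto simp: i_def glue_rel_eq)

lemma j_eq: "b \<in> points N \<Longrightarrow> j b = insert (Inr b) (Inl ` (D \<inter> f -` {b}))"
  using fD_sub D_sub by (auto simp: j_def glue_rel_eq)

lemma inj_i: "inj_on i (points M)" and inj_j: "inj_on j (points N)"
  by (auto simp: inj_on_def i_eq j_eq)

lemma i_eq_j: "a \<in> points M \<Longrightarrow> b \<in> points N \<Longrightarrow> i a = j b \<longleftrightarrow> a \<in> D \<and> b = f a"
  by (auto simp: i_eq j_eq dest: inj_onD[OF inj_f])

lemma j_eq_i: "a \<in> points M \<Longrightarrow> b \<in> points N \<Longrightarrow> j b = i a \<longleftrightarrow> a \<in> D \<and> b = f a"
  using i_eq_j by (metis (no_types))

lemma points_glue: "points G = i ` points M \<union> j ` points N"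
  by (auto simp: glue_def Let_def quotient_def i_def j_def)

text \<open>Openness in the glued space is tested on both pieces.  Together with \<open>i_eq_j\<close>, which says
  where the pieces meet, this makes both \<open>i\<close> and \<open>j\<close> open embeddings.\<close>

lemma openin_glue:
  "openin (mtop G) W \<longleftrightarrow> W \<subseteq> points G \<and>
     openin (mtop M) {a \<in> points M. i a \<in> W} \<and> openin (mtop N) {b \<in> points N. j b \<in> W}"
proof -
  let ?S = "{x \<in> points M <+> points N. r `` {x} \<in> W}"
  have "Inl -` ?S = {a \<in> points M. i a \<in> W}" "Inr -` ?S = {b \<in> points N. j b \<in> W}"
    by (auto simp: i_def j_def)
  then show ?thesis
    unfolding points_glue[symmetric]
    by (auto simp: glue_def Let_def openin_quotient_topology openin_coproduct_topology)
qed

lemma charts_glue: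
  "charts G = push_chart (points M) i ` charts M \<union> push_chart (points N) j ` charts N"
  unfolding glue_def Let_def i_def[abs_def] j_def[abs_def] by simp

lemma continuous_i: "continuous_map (mtop M) (mtop G) i"
  and continuous_j: "continuous_map (mtop N) (mtop G) j"
  by (auto simp: continuous_map_def openin_glue points_glue)

lemma continuous_f: "continuous_map (subtopology (mtop M) D) (mtop N) f"
  and continuous_inv_f: "continuous_map (subtopology (mtop N) (f ` D)) (mtop M) (inv_into D f)"
  using holo_f holo_inv_f
  by (auto simp: holo_map_def open_submanifold_def continuous_map_in_subtopology)

lemma open_f:
  assumes "openin (mtop M) S"
  shows "openin (mtop N) (f ` (S \<inter> D))"
proof -
  have "openin (subtopology (mtop N) (f ` D)) {b \<in> topspace (subtopology (mtop N) (f ` D)). inv_into D f b \<in> S}"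
    using continuous_inv_f assms by (rule openin_continuous_map_preimage)
  moreover have "{b \<in> topspace (subtopology (mtop N) (f ` D)). inv_into D f b \<in> S} = f ` (S \<inter> D)"
    using fD_sub inj_f by auto
  ultimately show ?thesis
    using fD by (simp add: openin_open_subtopology)
qed

lemma open_vimage_f:
  assumes "openin (mtop N) S"
  shows "openin (mtop M) {a \<in> D. f a \<in> S}"
proof -
  have "openin (subtopology (mtop M) D) {a \<in> topspace (subtopology (mtop M) D). f a \<in> S}"
    using continuous_f assms by (rule openin_continuous_map_preimage)
  moreover have "{a \<in> topspace (subtopology (mtop M) D). f a \<in> S} = {a \<in> D. f a \<in> S}"
    using D_sub by auto
  ultimately have "openin (subtopology (mtop M) D) {a \<in> D. f a \<in> S}"
    by (simp only:)
  then show ?thesis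
    using D by (simp only: openin_open_subtopology)
qed

lemma open_i: "open_map (mtop M) (mtop G) i"
  unfolding open_map_def
proof (intro allI impI)
  fix S assume S: "openin (mtop M) S"
  then have sub: "S \<subseteq> points M" by (rule openin_subset)
  have "{a \<in> points M. i a \<in> i ` S} = S"
    using sub inj_i by (auto dest: inj_onD)
  moreover have "{b \<in> points N. j b \<in> i ` S} = f ` (S \<inter> D)"
  proof -
    have "j b \<in> i ` S \<longleftrightarrow> (\<exists>a\<in>S. a \<in> D \<and> b = f a)" if "b \<in> points N" for b
      unfolding image_iff using that sub by (intro bex_cong refl j_eq_i) auto
    then show ?thesis using fD_sub by blast
  qed
  moreover have "i ` S \<subseteq> points G" using sub by (auto simp: points_glue)
  ultimately show "openin (mtop G) (i ` S)"
    using S open_f by (simp add: openin_glue)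
qed

lemma open_j: "open_map (mtop N) (mtop G) j"
  unfolding open_map_def
proof (intro allI impI)
  fix S assume S: "openin (mtop N) S"
  then have sub: "S \<subseteq> points N" by (rule openin_subset)
  have "{b \<in> points N. j b \<in> j ` S} = S"
    using sub inj_j by (auto dest: inj_onD)
  moreover have "{a \<in> points M. i a \<in> j ` S} = {a \<in> D. f a \<in> S}"
  proof -
    have "i a \<in> j ` S \<longleftrightarrow> (\<exists>b\<in>S. a \<in> D \<and> b = f a)" if "a \<in> points M" for a
      unfolding image_iff using that sub by (intro bex_cong refl i_eq_j) auto
    then show ?thesis using D_sub by blast
  qed
  moreover have "j ` S \<subseteq> points G" using sub by (auto simp: points_glue)
  ultimately show "openin (mtop G) (j ` S)"
    using S open_vimage_f by (simp add: openin_glue)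
qed

lemma disjoint_i_j_images:
  assumes "P \<subseteq> points M" "Q \<subseteq> points N" "f ` (P \<inter> D) \<inter> Q = {}"
  shows "i ` P \<inter> j ` Q = {}"
proof -
  have "i a \<noteq> j b" if "a \<in> P" "b \<in> Q" for a b
  proof -
    have "a \<in> points M" "b \<in> points N" using that assms by auto
    moreover have "\<not> (a \<in> D \<and> b = f a)" using that assms(3) by blast
    ultimately show ?thesis by (simp add: i_eq_j)
  qed
  then show ?thesis by blast
qed

lemma Hausdorff_M: "Hausdorff_space (mtop M)" and Hausdorff_N: "Hausdorff_space (mtop N)"
  using M N by (auto simp: complex_manifold_def)

text \<open>If both points lie in one piece, that piece separates them, because it is open and Hausdorff.
  Otherwise one point lies outside \<open>D\<close> and the other outside \<open>f ` D\<close>, and \<open>separated\<close> applies.\<close>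

lemma Hausdorff_glue: "Hausdorff_space (mtop G)"
proof -
  let ?sep = "\<lambda>x y. \<exists>U V. openin (mtop G) U \<and> openin (mtop G) V \<and> x \<in> U \<and> y \<in> V \<and> disjnt U V"
  have sym: "?sep x y" if "?sep y x" for x y
  proof -
    from that obtain U V where UV: "openin (mtop G) U" "openin (mtop G) V" "y \<in> U" "x \<in> V" "disjnt U V"
      by (elim exE conjE)
    from UV(5) have "disjnt V U" by (rule disjnt_sym)
    with UV(1-4) show ?thesis by (intro exI conjI)
  qed
  have ii: "?sep (i a) (i b)" if ab: "a \<in> points M" "b \<in> points M" "i a \<noteq> i b" for a b
  proof -
    have "a \<noteq> b" using ab(3) by (rule contrapos_nn) simp
    then have "\<exists>U V. openin (mtop M) U \<and> openin (mtop M) V \<and> a \<in> U \<and> b \<in> V \<and> disjnt U V"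
      using Hausdorff_M[unfolded Hausdorff_space_def, rule_format, of a b] ab(1,2) by (simp only: simp_thms)
    then obtain U V where UV: "openin (mtop M) U" "openin (mtop M) V" "a \<in> U" "b \<in> V" "disjnt U V"
      by (elim exE conjE)
    then have "i ` U \<inter> i ` V = i ` (U \<inter> V)"
      using inj_i by (intro inj_on_image_Int[symmetric]) (auto dest: openin_subset)
    then have "disjnt (i ` U) (i ` V)"
      using UV(5) by (simp add: disjnt_def)
    moreover have "openin (mtop G) (i ` U)" "openin (mtop G) (i ` V)"
      using UV(1,2) open_i by (auto simp: open_map_def)
    ultimately show ?thesis
      using UV(3,4) by (intro exI conjI) auto
  qed
  have jj: "?sep (j a) (j b)" if ab: "a \<in> points N" "b \<in> points N" "j a \<noteq> j b" for a b
  proof -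
    have "a \<noteq> b" using ab(3) by (rule contrapos_nn) simp
    then have "\<exists>U V. openin (mtop N) U \<and> openin (mtop N) V \<and> a \<in> U \<and> b \<in> V \<and> disjnt U V"
      using Hausdorff_N[unfolded Hausdorff_space_def, rule_format, of a b] ab(1,2) by (simp only: simp_thms)
    then obtain U V where UV: "openin (mtop N) U" "openin (mtop N) V" "a \<in> U" "b \<in> V" "disjnt U V"
      by (elim exE conjE)
    then have "j ` U \<inter> j ` V = j ` (U \<inter> V)"
      using inj_j by (intro inj_on_image_Int[symmetric]) (auto dest: openin_subset)
    then have "disjnt (j ` U) (j ` V)"
      using UV(5) by (simp add: disjnt_def)
    moreover have "openin (mtop G) (j ` U)" "openin (mtop G) (j ` V)"
      using UV(1,2) open_j by (auto simp: open_map_def)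
    ultimately show ?thesis
      using UV(3,4) by (intro exI conjI) auto
  qed
  have ij: "?sep (i a) (j b)" if ab: "a \<in> points M" "b \<in> points N" "i a \<noteq> j b" for a b
  proof (cases "a \<in> D")
    case True
    then have fa: "f a \<in> points N" using fD_sub by blast
    with True ab(1) have eq: "i a = j (f a)" by (simp add: i_eq_j)
    show ?thesis
      using ab(3) unfolding eq by (rule jj[OF fa ab(2)])
  next
    case aD: False
    show ?thesis
    proof (cases "b \<in> f ` D")
      case True
      then obtain c where c: "c \<in> D" "b = f c" by auto
      then have cM: "c \<in> points M" using D_sub by blast
      with c ab(2) have eq: "j b = i c" by (simp add: j_eq_i)
      show ?thesis
        using ab(3) unfolding eq by (rule ii[OF ab(1) cM])
    next
      case False
      with aD ab have "a \<in> points M - D" "b \<in> points N - f ` D" by simp_all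
      from separated[OF this] obtain P Q where PQ: "openin (mtop M) P" "openin (mtop N) Q"
          "a \<in> P" "b \<in> Q" "f ` (P \<inter> D) \<inter> Q = {}"
        by (elim exE conjE)
      then have "disjnt (i ` P) (j ` Q)"
        unfolding disjnt_def by (intro disjoint_i_j_images) (auto dest: openin_subset)
      moreover have "openin (mtop G) (i ` P)" "openin (mtop G) (j ` Q)"
        using PQ(1,2) open_i open_j by (auto simp: open_map_def)
      ultimately show ?thesis
        using PQ(3,4) by (intro exI conjI) auto
    qed
  qed
  have sep: "?sep x y" if "x \<in> i ` points M \<union> j ` points N" "y \<in> i ` points M \<union> j ` points N" "x \<noteq> y" for x y
    using that(1,2)
  proof (elim UnE imageE)
    fix a b assume "x = i a" "y = i b" "a \<in> points M" "b \<in> points M"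
    then show ?thesis using that(3) by (simp only:) (rule ii)
  next
    fix a b assume "x = i a" "y = j b" "a \<in> points M" "b \<in> points N"
    then show ?thesis using that(3) by (simp only:) (rule ij)
  next
    fix a b assume "x = j a" "y = i b" "a \<in> points N" "b \<in> points M"
    then have "?sep y x" using that(3) by (simp only:) (rule ij, auto)
    then show ?thesis by (rule sym)
  next
    fix a b assume "x = j a" "y = j b" "a \<in> points N" "b \<in> points N"
    then show ?thesis using that(3) by (simp only:) (rule jj)
  qed
  show ?thesis
    unfolding Hausdorff_space_def points_glue
    by (intro allI impI, elim conjE, rule sep)
qed

lemma second_countable_glue: "second_countable (mtop G)"
proof -
  obtain \<B> where B: "countable \<B>" "\<And>V. V \<in> \<B> \<Longrightarrow> openin (mtop M) V"
      "\<And>U x. openin (mtop M) U \<Longrightarrow> x \<in> U \<Longrightarrow> \<exists>V\<in>\<B>. x \<in> V \<and> V \<subseteq> U"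
    using M unfolding complex_manifold_def second_countable_def by metis
  obtain \<C> where C: "countable \<C>" "\<And>V. V \<in> \<C> \<Longrightarrow> openin (mtop N) V"
      "\<And>U x. openin (mtop N) U \<Longrightarrow> x \<in> U \<Longrightarrow> \<exists>V\<in>\<C>. x \<in> V \<and> V \<subseteq> U"
    using N unfolding complex_manifold_def second_countable_def by metis
  show ?thesis
    unfolding second_countable_def
  proof (intro exI conjI allI impI ballI)
    \<comment> \<open>The images of two countable bases form a basis, as both embeddings are open.\<close>
    show "countable ((`) i ` \<B> \<union> (`) j ` \<C>)"
      using B(1) C(1) by auto
    show "openin (mtop G) V" if "V \<in> (`) i ` \<B> \<union> (`) j ` \<C>" for V
      using that B(2) C(2) open_i open_j by (auto simp: open_map_def)
    fix U x assume Ux: "openin (mtop G) U \<and> x \<in> U"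
    then have "x \<in> i ` points M \<union> j ` points N"
      using openin_subset points_glue by blast
    then show "\<exists>V \<in> (`) i ` \<B> \<union> (`) j ` \<C>. x \<in> V \<and> V \<subseteq> U"
    proof
      assume "x \<in> i ` points M"
      then obtain a where a: "a \<in> points M" "x = i a" by auto
      have "openin (mtop M) {a \<in> points M. i a \<in> U}" using Ux by (simp add: openin_glue)
      then obtain V where "V \<in> \<B>" "a \<in> V" "V \<subseteq> {a \<in> points M. i a \<in> U}"
        using B(3) a Ux by (metis (mono_tags, lifting) mem_Collect_eq)
      then show ?thesis using a by (intro bexI[of _ "i ` V"]) auto
    next
      assume "x \<in> j ` points N"
      then obtain a where a: "a \<in> points N" "x = j a" by auto
      have "openin (mtop N) {a \<in> points N. j a \<in> U}" using Ux by (simp add: openin_glue)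
      then obtain V where "V \<in> \<C>" "a \<in> V" "V \<subseteq> {a \<in> points N. j a \<in> U}"
        using C(3) a Ux by (metis (mono_tags, lifting) mem_Collect_eq)
      then show ?thesis using a by (intro bexI[of _ "j ` V"]) auto
    qed
  qed
qed

lemma chart_M: "(V, \<psi>) \<in> charts M \<Longrightarrow> is_chart (mtop M) (V, \<psi>)"
  and chart_N: "(W, \<theta>) \<in> charts N \<Longrightarrow> is_chart (mtop N) (W, \<theta>)"
  using M N by (auto simp: complex_manifold_def)

lemma chart_M': "(V, \<psi>) \<in> charts M \<Longrightarrow> V \<subseteq> points M \<and> inj_on \<psi> V \<and> openin (mtop M) V"
  and chart_N': "(W, \<theta>) \<in> charts N \<Longrightarrow> W \<subseteq> points N \<and> inj_on \<theta> W \<and> openin (mtop N) W"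
  using chart_M[of V \<psi>] chart_N[of W \<theta>] by (auto simp: is_chart_iff dest: openin_subset)

lemma is_chart_glue:
  assumes "c \<in> charts G"
  shows "is_chart (mtop G) c"
  using assms unfolding charts_glue
proof (elim UnE imageE)
  fix d assume d: "c = push_chart (points M) i d" "d \<in> charts M"
  obtain V \<psi> where "d = (V, \<psi>)" by (cases d)
  with d show ?thesis
    using is_chart_push_chart[OF continuous_i open_i inj_i chart_M] by simp
next
  fix d assume d: "c = push_chart (points N) j d" "d \<in> charts N"
  obtain V \<psi> where "d = (V, \<psi>)" by (cases d)
  with d show ?thesis
    using is_chart_push_chart[OF continuous_j open_j inj_j chart_N] by simp
qed

lemma charts_cover_glue: "(\<Union>c\<in>charts G. fst c) = points G"
proof -
  have "(\<Union>c\<in>charts M. fst (push_chart (points M) i c)) = i ` (\<Union>c\<in>charts M. fst c)"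
    "(\<Union>c\<in>charts N. fst (push_chart (points N) j c)) = j ` (\<Union>c\<in>charts N. fst c)"
    by (auto simp: push_chart_def case_prod_unfold image_iff)
  moreover have "(\<Union>c\<in>charts M. fst c) = points M" "(\<Union>c\<in>charts N. fst c) = points N"
    using M N by (auto simp: complex_manifold_def)
  ultimately show ?thesis
    unfolding charts_glue points_glue by (simp add: UN_Un)
qed

lemma transition_MM:
  assumes c: "(V, \<psi>) \<in> charts M" and d: "(W, \<theta>) \<in> charts M"
  shows "holo_transition (push_chart (points M) i (V, \<psi>)) (push_chart (points M) i (W, \<theta>))"
proof (rule holo_transition_push_chart[where g = "\<lambda>v. v" and P = "V \<inter> W" and h = "\<theta> \<circ> inv_into V \<psi>", OF inj_i inj_i])
  have "holo_transition (V, \<psi>) (W, \<theta>)"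
    using M c d by (auto simp: complex_manifold_def)
  then show "holo_on (\<theta> \<circ> inv_into V \<psi>) (\<psi> ` (V \<inter> W))"
    by (simp add: holo_transition_def)
  show "open (\<psi> ` (V \<inter> W))"
    using chart_M'[OF d] by (intro is_chart_image_open[OF chart_M[OF c]]) simp
  show "v \<in> V \<inter> W" if "v \<in> V" "i v \<in> i ` W" for v
    using that chart_M'[OF c] chart_M'[OF d] inj_on_image_mem_iff[OF inj_i, of v W] by blast
qed (use chart_M'[OF c] chart_M'[OF d] in auto)

lemma transition_NN:
  assumes c: "(V, \<psi>) \<in> charts N" and d: "(W, \<theta>) \<in> charts N"
  shows "holo_transition (push_chart (points N) j (V, \<psi>)) (push_chart (points N) j (W, \<theta>))"
proof (rule holo_transition_push_chart[where g = "\<lambda>v. v" and P = "V \<inter> W" and h = "\<theta> \<circ> inv_into V \<psi>", OF inj_j inj_j])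
  have "holo_transition (V, \<psi>) (W, \<theta>)"
    using N c d by (auto simp: complex_manifold_def)
  then show "holo_on (\<theta> \<circ> inv_into V \<psi>) (\<psi> ` (V \<inter> W))"
    by (simp add: holo_transition_def)
  show "open (\<psi> ` (V \<inter> W))"
    using chart_N'[OF d] by (intro is_chart_image_open[OF chart_N[OF c]]) simp
  show "v \<in> V \<inter> W" if "v \<in> V" "j v \<in> j ` W" for v
    using that chart_N'[OF c] chart_N'[OF d] inj_on_image_mem_iff[OF inj_j, of v W] by blast
qed (use chart_N'[OF c] chart_N'[OF d] in auto)

lemma transition_MN:
  assumes c: "(V, \<psi>) \<in> charts M" and d: "(W, \<theta>) \<in> charts N"
  shows "holo_transition (push_chart (points M) i (V, \<psi>)) (push_chart (points N) j (W, \<theta>))"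
proof (rule holo_transition_push_chart[where g = f and P = "V \<inter> {a \<in> D. f a \<in> W}"
      and h = "\<theta> \<circ> f \<circ> inv_into (V \<inter> D) \<psi>", OF inj_i inj_j])
  have "(V \<inter> D, \<psi>) \<in> charts (open_submanifold M D)" "(W \<inter> f ` D, \<theta>) \<in> charts (open_submanifold N (f ` D))"
    using c d by (force simp: open_submanifold_def)+
  then have "holo_on (\<theta> \<circ> f \<circ> inv_into (V \<inter> D) \<psi>) (\<psi> ` ((V \<inter> D) \<inter> f -` (W \<inter> f ` D)))"
    using holo_f unfolding holo_map_def by blast
  moreover have "(V \<inter> D) \<inter> f -` (W \<inter> f ` D) = V \<inter> {a \<in> D. f a \<in> W}" by auto
  ultimately show "holo_on (\<theta> \<circ> f \<circ> inv_into (V \<inter> D) \<psi>) (\<psi> ` (V \<inter> {a \<in> D. f a \<in> W}))"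
    by simp
  show "open (\<psi> ` (V \<inter> {a \<in> D. f a \<in> W}))"
    using chart_N'[OF d] by (intro is_chart_image_open[OF chart_M[OF c]] open_vimage_f) simp
  show "(\<theta> \<circ> f \<circ> inv_into (V \<inter> D) \<psi>) (\<psi> v) = \<theta> (f v)" if "v \<in> V \<inter> {a \<in> D. f a \<in> W}" for v
  proof -
    have "inj_on \<psi> (V \<inter> D)" using chart_M'[OF c] by (auto intro: inj_on_subset)
    then show ?thesis using that by simp
  qed
  show "v \<in> V \<inter> {a \<in> D. f a \<in> W}" if v: "v \<in> V" "i v \<in> j ` W" for v
  proof -
    obtain w where w: "w \<in> W" "i v = j w" using v(2) by blast
    moreover have "v \<in> points M" "w \<in> points N"
      using v(1) w(1) chart_M'[OF c] chart_N'[OF d] by auto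
    ultimately show ?thesis using v(1) i_eq_j[of v w] by simp
  qed
  show "f v \<in> W \<and> i v = j (f v)" if "v \<in> V \<inter> {a \<in> D. f a \<in> W}" for v
  proof -
    have "v \<in> points M" "f v \<in> points N" using that D_sub fD_sub by auto
    then show ?thesis using that i_eq_j by simp
  qed
qed (use chart_M'[OF c] chart_N'[OF d] in auto)

lemma transition_NM:
  assumes c: "(V, \<psi>) \<in> charts N" and d: "(W, \<theta>) \<in> charts M"
  shows "holo_transition (push_chart (points N) j (V, \<psi>)) (push_chart (points M) i (W, \<theta>))"
proof (rule holo_transition_push_chart[where g = "inv_into D f" and P = "V \<inter> f ` (W \<inter> D)"
      and h = "\<theta> \<circ> inv_into D f \<circ> inv_into (V \<inter> f ` D) \<psi>", OF inj_j inj_i])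
  have "(V \<inter> f ` D, \<psi>) \<in> charts (open_submanifold N (f ` D))" "(W \<inter> D, \<theta>) \<in> charts (open_submanifold M D)"
    using c d by (force simp: open_submanifold_def)+
  then have "holo_on (\<theta> \<circ> inv_into D f \<circ> inv_into (V \<inter> f ` D) \<psi>)
      (\<psi> ` ((V \<inter> f ` D) \<inter> inv_into D f -` (W \<inter> D)))"
    using holo_inv_f unfolding holo_map_def by blast
  moreover have "(V \<inter> f ` D) \<inter> inv_into D f -` (W \<inter> D) = V \<inter> f ` (W \<inter> D)"
    using inj_f by auto
  ultimately show "holo_on (\<theta> \<circ> inv_into D f \<circ> inv_into (V \<inter> f ` D) \<psi>) (\<psi> ` (V \<inter> f ` (W \<inter> D)))"
    by simp
  show "open (\<psi> ` (V \<inter> f ` (W \<inter> D)))"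
    using chart_M'[OF d] by (intro is_chart_image_open[OF chart_N[OF c]] open_f) simp
  show "(\<theta> \<circ> inv_into D f \<circ> inv_into (V \<inter> f ` D) \<psi>) (\<psi> v) = \<theta> (inv_into D f v)"
    if "v \<in> V \<inter> f ` (W \<inter> D)" for v
  proof -
    have "inj_on \<psi> (V \<inter> f ` D)" using chart_N'[OF c] by (auto intro: inj_on_subset)
    moreover have "v \<in> V \<inter> f ` D" using that by blast
    ultimately show ?thesis by simp
  qed
  show "v \<in> V \<inter> f ` (W \<inter> D)" if v: "v \<in> V" "j v \<in> i ` W" for v
  proof -
    obtain w where w: "w \<in> W" "j v = i w" using v(2) by blast
    moreover have "v \<in> points N" "w \<in> points M"
      using v(1) w(1) chart_N'[OF c] chart_M'[OF d] by auto
    ultimately show ?thesis using v(1) j_eq_i[of w v] by simp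
  qed
  show "inv_into D f v \<in> W \<and> j v = i (inv_into D f v)" if v: "v \<in> V \<inter> f ` (W \<inter> D)" for v
  proof -
    obtain a where a: "a \<in> W" "a \<in> D" "v = f a" using v by blast
    have "a \<in> points M" "v \<in> points N" using a D_sub fD_sub by auto
    then have "j v = i a" using a by (simp add: j_eq_i)
    moreover have "inv_into D f v = a" using a inj_f by simp
    ultimately show ?thesis using a(1) by simp
  qed
qed (use chart_M'[OF d] chart_N'[OF c] in auto)

lemma holo_transition_glue:
  assumes "c \<in> charts G" "d \<in> charts G"
  shows "holo_transition c d"
proof -
  have "(\<exists>V \<psi>. (V, \<psi>) \<in> charts M \<and> c = push_chart (points M) i (V, \<psi>)) \<or>
      (\<exists>V \<psi>. (V, \<psi>) \<in> charts N \<and> c = push_chart (points N) j (V, \<psi>))" if "c \<in> charts G" for c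
    using that unfolding charts_glue by (auto simp del: split_paired_Ex)
  from this[OF assms(1)] this[OF assms(2)] show ?thesis
    by (elim disjE exE conjE) (simp_all only: transition_MM transition_MN transition_NM transition_NN)
qed

lemma continuous_map_glue:
  assumes "continuous_map (mtop M) T (\<lambda>a. q (i a))" "continuous_map (mtop N) T (\<lambda>b. q (j b))"
  shows "continuous_map (mtop G) T q"
  unfolding continuous_map_def
proof (intro conjI allI impI)
  show "q \<in> points G \<rightarrow> topspace T"
    using assms by (auto simp: points_glue continuous_map_def)
  fix S assume S: "openin T S"
  have "{a \<in> points M. i a \<in> {x \<in> points G. q x \<in> S}} = {a \<in> points M. q (i a) \<in> S}"
    "{b \<in> points N. j b \<in> {x \<in> points G. q x \<in> S}} = {b \<in> points N. q (j b) \<in> S}"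
    by (auto simp: points_glue)
  then show "openin (mtop G) {x \<in> points G. q x \<in> S}"
    using openin_continuous_map_preimage[OF assms(1) S] openin_continuous_map_preimage[OF assms(2) S]
    unfolding openin_glue by (intro conjI) (simp_all only:, blast)
qed

theorem complex_manifold_glue: "complex_manifold G"
  unfolding complex_manifold_def
  by (intro conjI ballI Hausdorff_glue second_countable_glue is_chart_glue charts_cover_glue
      holo_transition_glue)

end

section \<open>The coordinate space with one more coordinate\<close>

definition spatial :: "complex^('n::finite option) \<Rightarrow> complex^'n" where
  "spatial w = (\<chi> i. w $ Some i)"

lemma join_nth [simp]: "join z t $ None = t" "join z t $ Some i = z $ i"
  by (simp_all add: join_def)

lemma spatial_nth [simp]: "spatial w $ i = w $ Some i"
  by (simp add: spatial_def)

lemma spatial_join [simp]: "spatial (join z t) = z"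
  by (simp add: vec_eq_iff)

lemma vec_option_eq_iff: "w = w' \<longleftrightarrow> spatial w = spatial w' \<and> w $ None = w' $ None"
  unfolding vec_eq_iff by (metis option.exhaust spatial_nth)

lemma join_eq_iff [simp]: "join z t = join z' t' \<longleftrightarrow> z = z' \<and> t = t'"
  by (simp add: vec_option_eq_iff)

lemma continuous_on_join [continuous_intros]:
  assumes "continuous_on S f" "continuous_on S g"
  shows "continuous_on S (\<lambda>x. join (f x) (g x))"
  unfolding join_def
proof (rule continuous_on_vec_lambda)
  fix k show "continuous_on S (\<lambda>x. case k of None \<Rightarrow> g x | Some i \<Rightarrow> f x $ i)"
    using assms by (cases k) (auto intro: continuous_intros)
qed

lemma continuous_on_spatial [continuous_intros]:
  "continuous_on S f \<Longrightarrow> continuous_on S (\<lambda>x. spatial (f x))"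
  unfolding spatial_def by (intro continuous_intros)

lemma open_join_image:
  assumes "open A" "open B"
  shows "open ((\<lambda>(z, t). join z t) ` (A \<times> B))"
proof -
  have "(\<lambda>(z, t). join z t) ` (A \<times> B) = spatial -` A \<inter> (\<lambda>w. w $ None) -` B"
    by (auto simp: image_iff vec_option_eq_iff)
  moreover have "open (spatial -` A)" "open ((\<lambda>w. w $ None) -` B)"
    using assms by (auto intro!: open_vimage continuous_intros)
  ultimately show ?thesis by auto
qed

lemma holo_on_spatial: "holo_on (spatial :: complex^('a::finite option) \<Rightarrow> _) S"
proof (rule holo_on_componentwise)
  fix k and z :: "complex^('a option)"
  show "\<exists>D. ((\<lambda>w. spatial w $ k) has_derivative D) (at z) \<and> (\<forall>c h. D (c *s h) = c * D h)"
    by (intro exI[of _ "\<lambda>h. h $ Some k"])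
      (auto intro: bounded_linear_imp_has_derivative bounded_linear_vec_nth)
qed

lemma holo_on_join:
  assumes "holo_on h S"
  shows "holo_on (\<lambda>w. join (h w) (w $ None)) S"
proof (rule holo_on_componentwise)
  fix k z assume "z \<in> S"
  then obtain D where D: "(h has_derivative D) (at z)" "Vector_Spaces.linear (*s) (*s) D"
    using assms by (auto simp: holo_on_def)
  show "\<exists>D. ((\<lambda>w. join (h w) (w $ None) $ k) has_derivative D) (at z) \<and>
      (\<forall>c h. D (c *s h) = c * D h)"
  proof (cases k)
    case None
    then show ?thesis
      by (intro exI[of _ "\<lambda>h. h $ None"])
        (auto intro: bounded_linear_imp_has_derivative bounded_linear_vec_nth)
  next
    case (Some i)
    have "((\<lambda>w. h w $ i) has_derivative (\<lambda>v. D v $ i)) (at z)"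
      by (rule bounded_linear.has_derivative[OF bounded_linear_vec_nth D(1)])
    then show ?thesis
      using D(2) Some by (intro exI[of _ "\<lambda>v. D v $ i"]) (auto simp: vec.linear_scale)
  qed
qed

section \<open>Products with the punctured plane, and open subsets of coordinate space\<close>

lemma second_countable_prod_topology:
  assumes "second_countable X" "second_countable Y"
  shows "second_countable (prod_topology X Y)"
proof -
  obtain \<B> where B: "countable \<B>" "\<And>V. V \<in> \<B> \<Longrightarrow> openin X V"
      "\<And>U x. openin X U \<Longrightarrow> x \<in> U \<Longrightarrow> \<exists>V\<in>\<B>. x \<in> V \<and> V \<subseteq> U"
    using assms(1) unfolding second_countable_def by metis
  obtain \<C> where C: "countable \<C>" "\<And>V. V \<in> \<C> \<Longrightarrow> openin Y V"
      "\<And>U x. openin Y U \<Longrightarrow> x \<in> U \<Longrightarrow> \<exists>V\<in>\<C>. x \<in> V \<and> V \<subseteq> U"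
    using assms(2) unfolding second_countable_def by metis
  show ?thesis
    unfolding second_countable_def
  proof (intro exI conjI allI impI ballI)
    show "countable ((\<lambda>(V, W). V \<times> W) ` (\<B> \<times> \<C>))"
      using B(1) C(1) by auto
    show "openin (prod_topology X Y) V" if "V \<in> (\<lambda>(V, W). V \<times> W) ` (\<B> \<times> \<C>)" for V
      using that B(2) C(2) by (auto simp: openin_prod_Times_iff)
    fix U z assume Uz: "openin (prod_topology X Y) U \<and> z \<in> U"
    obtain x y where z: "z = (x, y)" by (cases z)
    obtain P Q where PQ: "openin X P" "openin Y Q" "x \<in> P" "y \<in> Q" "P \<times> Q \<subseteq> U"
      using Uz unfolding z openin_prod_topology_alt by blast
    obtain V W where "V \<in> \<B>" "x \<in> V" "V \<subseteq> P" "W \<in> \<C>" "y \<in> W" "W \<subseteq> Q"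
      using B(3)[OF PQ(1,3)] C(3)[OF PQ(2,4)] by blast
    then show "\<exists>V \<in> (\<lambda>(V, W). V \<times> W) ` (\<B> \<times> \<C>). z \<in> V \<and> V \<subseteq> U"
      using PQ(5) z by (intro bexI[of _ "V \<times> W"]) auto
  qed
qed

lemma second_countable_top_of_set:
  "second_countable (top_of_set (S :: 'a::second_countable_topology set))"
proof -
  obtain \<B> :: "'a set set" where B: "countable \<B>" "\<And>V. V \<in> \<B> \<Longrightarrow> open V"
      "\<And>U. open U \<Longrightarrow> \<exists>\<V>. \<V> \<subseteq> \<B> \<and> U = \<Union>\<V>"
    using univ_second_countable by metis
  show ?thesis
    unfolding second_countable_def
  proof (intro exI conjI allI impI ballI)
    show "countable ((\<inter>) S ` \<B>)" using B(1) by simp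
    show "openin (top_of_set S) V" if "V \<in> (\<inter>) S ` \<B>" for V
      using that B(2) by auto
    fix U x assume Ux: "openin (top_of_set S) U \<and> x \<in> U"
    then obtain O' where O': "open O'" "U = S \<inter> O'"
      by (auto simp: openin_open)
    obtain \<V> where "\<V> \<subseteq> \<B>" "O' = \<Union>\<V>" using B(3)[OF O'(1)] by blast
    then obtain V where "V \<in> \<B>" "x \<in> V" "V \<subseteq> O'" using Ux O' by blast
    then show "\<exists>V \<in> (\<inter>) S ` \<B>. x \<in> V \<and> V \<subseteq> U"
      using Ux O' by (intro bexI[of _ "S \<inter> V"]) auto
  qed
qed

text \<open>The product chart is \<open>\<psi> \<times> id\<close> followed by the identification \<open>join\<close> of \<open>\<complex>\<^sup>n \<times> \<complex>\<close> with
  \<open>\<complex>\<^sup>n\<^sup>+\<^sup>1\<close>; openness is checked on boxes.\<close>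

lemma is_chart_times_Cstar:
  assumes "is_chart T (V, \<psi>)"
  shows "is_chart (prod_topology T (top_of_set (- {0}))) (V \<times> (- {0}), \<lambda>(x, t). join (\<psi> x) t)"
proof -
  let ?P = "prod_topology T (top_of_set (- {0::complex}))"
  let ?\<Psi> = "\<lambda>(x, t). join (\<psi> x) t"
  have V: "openin T V" and inj: "inj_on \<psi> V"
    and c: "continuous_map (subtopology T V) euclidean \<psi>"
    and op: "\<And>S. openin T S \<Longrightarrow> S \<subseteq> V \<Longrightarrow> open (\<psi> ` S)"
    using assms by (auto simp: is_chart_iff)
  have "openin ?P (V \<times> - {0})"
    using V by (simp add: openin_prod_Times_iff)
  moreover have "inj_on ?\<Psi> (V \<times> - {0})"
    using inj by (auto simp: inj_on_def)
  moreover have "continuous_map (subtopology ?P (V \<times> - {0})) euclidean ?\<Psi>"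
  proof -
    have sub: "subtopology ?P (V \<times> - {0}) = prod_topology (subtopology T V) (top_of_set (- {0}))"
      by (simp add: subtopology_Times subtopology_subtopology)
    have "continuous_map (prod_topology (subtopology T V) (top_of_set (- {0})))
        (prod_topology euclidean euclidean) (\<lambda>(x, t). (\<psi> x, t :: complex))"
      unfolding continuous_map_prod_top using c by (simp add: continuous_map_from_subtopology)
    moreover have "continuous_map (prod_topology euclidean euclidean) euclidean (\<lambda>(z, t). join z t)"
      unfolding prod_topology_euclidean continuous_map_iff_continuous2 case_prod_unfold
      by (intro continuous_intros)
    ultimately have "continuous_map (prod_topology (subtopology T V) (top_of_set (- {0}))) euclidean
        ((\<lambda>(z, t). join z t) \<circ> (\<lambda>(x, t). (\<psi> x, t)))"
      by (rule continuous_map_compose)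
    then show ?thesis
      unfolding sub by (simp add: comp_def case_prod_unfold)
  qed
  moreover have "open (?\<Psi> ` S)" if S: "openin ?P S" "S \<subseteq> V \<times> - {0}" for S
  proof (subst open_subopen, clarify)
    fix x t assume xt: "(x, t) \<in> S"
    obtain P Q where PQ: "openin T P" "openin (top_of_set (- {0})) Q" "x \<in> P" "t \<in> Q" "P \<times> Q \<subseteq> S"
      using S(1)[unfolded openin_prod_topology_alt, rule_format, OF xt] by (elim exE conjE)
    have "P \<subseteq> V" using PQ(4,5) S(2) by blast
    then have "open (\<psi> ` P)" by (rule op[OF PQ(1)])
    moreover have "open Q" using PQ(2) by (rule openin_open_trans) auto
    ultimately have "open ((\<lambda>(z, t). join z t) ` (\<psi> ` P \<times> Q))"
      by (rule open_join_image)
    then show "\<exists>T. open T \<and> join (\<psi> x) t \<in> T \<and> T \<subseteq> ?\<Psi> ` S"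
      using PQ(3,4,5) by (intro exI[of _ "(\<lambda>(z, t). join z t) ` (\<psi> ` P \<times> Q)"]) force
  qed
  ultimately show ?thesis
    unfolding is_chart_iff by blast
qed

lemma complex_manifold_times_Cstar:
  assumes X: "complex_manifold X"
  shows "complex_manifold (times_Cstar X)"
proof -
  have X_chart: "is_chart (mtop X) (V, \<psi>)" if "(V, \<psi>) \<in> charts X" for V \<psi>
    using X that by (auto simp: complex_manifold_def)
  have chart: "is_chart (mtop (times_Cstar X)) c" if "c \<in> charts (times_Cstar X)" for c
    using that X_chart by (auto simp: times_Cstar_def intro: is_chart_times_Cstar)
  have haus: "Hausdorff_space (mtop (times_Cstar X))"
    using X by (simp add: complex_manifold_def times_Cstar_def Hausdorff_space_prod_topology
        Hausdorff_space_subtopology)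
  have sc: "second_countable (mtop (times_Cstar X))"
    using X by (simp add: complex_manifold_def times_Cstar_def second_countable_prod_topology
        second_countable_top_of_set)
  have cover: "(\<Union>c\<in>charts (times_Cstar X). fst c) = points (times_Cstar X)"
  proof -
    have "(\<Union>c\<in>charts (times_Cstar X). fst c) = (\<Union>c\<in>charts X. fst c) \<times> - {0}"
      by (auto simp: times_Cstar_def case_prod_unfold)
    then show ?thesis
      using X by (simp add: complex_manifold_def times_Cstar_def)
  qed
  have trans: "holo_transition (V \<times> - {0}, \<lambda>(x, t). join (\<psi> x) t) (W \<times> - {0}, \<lambda>(x, t). join (\<theta> x) t)"
    if c: "(V, \<psi>) \<in> charts X" and d: "(W, \<theta>) \<in> charts X" for V \<psi> W \<theta>
  proof -
    let ?\<Psi> = "\<lambda>(x, t). join (\<psi> x) (t :: complex)" and ?\<Theta> = "\<lambda>(x, t). join (\<theta> x) (t :: complex)"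
    have inj: "inj_on \<psi> V" and "openin (mtop X) W"
      using X_chart[OF c] X_chart[OF d] by (auto simp: is_chart_iff)
    have inj': "inj_on ?\<Psi> (V \<times> - {0})"
      using is_chart_times_Cstar[OF X_chart[OF c]] by (simp add: is_chart_iff)
    have int: "(V \<times> - {0}) \<inter> (W \<times> - {0}) = (V \<inter> W) \<times> (- {0::complex})" by auto
    have im: "?\<Psi> ` ((V \<inter> W) \<times> - {0}) = (\<lambda>(z, t). join z t) ` (\<psi> ` (V \<inter> W) \<times> - {0})"
      by force
    have op: "open (?\<Psi> ` ((V \<inter> W) \<times> - {0}))"
      unfolding im using is_chart_image_open[OF X_chart[OF c] \<open>openin (mtop X) W\<close>]
      by (intro open_join_image) auto
    have "holo_transition (V, \<psi>) (W, \<theta>)"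
      using X c d by (auto simp: complex_manifold_def)
    then have "holo_on (\<theta> \<circ> inv_into V \<psi>) (\<psi> ` (V \<inter> W))"
      by (simp add: holo_transition_def)
    then have "holo_on (\<lambda>w. join (((\<theta> \<circ> inv_into V \<psi>) \<circ> spatial) w) (w $ None)) (?\<Psi> ` ((V \<inter> W) \<times> - {0}))"
      by (intro holo_on_join holo_on_compose[OF holo_on_spatial]) auto
    then have "holo_on (?\<Theta> \<circ> inv_into (V \<times> - {0}) ?\<Psi>) (?\<Psi> ` ((V \<inter> W) \<times> - {0}))"
    proof (rule holo_on_cong_open[OF op])
      fix w assume "w \<in> ?\<Psi> ` ((V \<inter> W) \<times> - {0})"
      then obtain x t where "x \<in> V" "t \<noteq> 0" "w = ?\<Psi> (x, t)" by auto
      moreover have "inv_into (V \<times> - {0}) ?\<Psi> (?\<Psi> (x, t)) = (x, t)"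
        using inj' calculation by (intro inv_into_f_f) auto
      ultimately show "join (((\<theta> \<circ> inv_into V \<psi>) \<circ> spatial) w) (w $ None) =
          (?\<Theta> \<circ> inv_into (V \<times> - {0}) ?\<Psi>) w"
        using inj by simp
    qed
    then show ?thesis
      unfolding holo_transition_def prod.case int .
  qed
  show ?thesis
    unfolding complex_manifold_def
    using haus sc chart cover trans by (auto simp: times_Cstar_def)
qed

lemma is_chart_id:
  assumes "open S"
  shows "is_chart (top_of_set S) (S, id)"
  unfolding is_chart_iff using assms by (simp add: openin_open_eq subtopology_subtopology)

lemma complex_manifold_open_subset:
  fixes S :: "(complex^'m::finite) set"
  assumes "open S"
  shows "complex_manifold (open_subset_manifold S)"
proof -
  have "holo_on (id \<circ> inv_into S id) S"
    by (rule holo_on_cong_open[OF assms holo_on_id]) (simp add: inv_into_f_eq)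
  then show ?thesis
    using is_chart_id[OF assms]
    by (simp add: complex_manifold_def open_subset_manifold_def holo_transition_def
        Hausdorff_space_subtopology second_countable_top_of_set)
qed

lemma vec_None_has_derivative:
  "((\<lambda>w :: complex^('n::finite option). vec (w $ None) :: complex^1) has_derivative (\<lambda>h. vec (h $ None))) (at z)"
proof -
  have "((\<lambda>w :: complex^('n::finite option). (vec (w $ None) :: complex^1) $ k) has_derivative (\<lambda>h. h $ None)) (at z)" for k
    by (simp add: bounded_linear_imp_has_derivative bounded_linear_vec_nth)
  from has_derivative_vec[of "\<lambda>w. vec (w $ None)", OF this] show ?thesis
    by (simp add: vec_def)
qed

section \<open>Weighted scaling\<close>

text \<open>Integer weights, so that the scaling and its inverse are instances of the same map.\<close>

definition weighted_scale :: "int^'n \<Rightarrow> complex^('n::finite option) \<Rightarrow> complex^('n option)" where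
  "weighted_scale k w = join (\<chi> i. (w $ None) powi (k $ i) * w $ Some i) (w $ None)"

lemma weighted_scale_None [simp]: "weighted_scale k w $ None = w $ None"
  by (simp add: weighted_scale_def)

lemma weighted_scale_inverse:
  "w $ None \<noteq> 0 \<Longrightarrow> weighted_scale (- k) (weighted_scale k w) = w"
  by (simp add: weighted_scale_def vec_option_eq_iff vec_eq_iff power_int_minus)

lemma holo_on_weighted_scale: "holo_on (weighted_scale k) {w. w $ None \<noteq> 0}"
proof -
  have "holo_on (\<lambda>w. \<chi> i. (w $ None) powi (k $ i) * w $ Some i) {w. w $ None \<noteq> 0}"
  proof (rule holo_on_componentwise)
    fix i :: 'a and z :: "complex^('a option)" assume "z \<in> {w. w $ None \<noteq> 0}"
    then have z: "z $ None \<noteq> 0" by simp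
    let ?c = "of_int (k $ i) * (z $ None) powi (k $ i - 1)"
    have 1: "((\<lambda>w. w $ None) has_derivative (\<lambda>h. h $ None)) (at z)"
      and 2: "((\<lambda>w. w $ Some i) has_derivative (\<lambda>h. h $ Some i)) (at z)"
      by (auto intro: bounded_linear_imp_has_derivative bounded_linear_vec_nth)
    have "((\<lambda>w. (w $ None) powi (k $ i)) has_derivative (\<lambda>h. h $ None * ?c)) (at z)"
      using has_derivative_power_int[OF z 1, of "k $ i"] by simp
    from has_derivative_mult[OF this 2]
    have "((\<lambda>w. (\<chi> i. (w $ None) powi (k $ i) * w $ Some i) $ i) has_derivative
        (\<lambda>h. (z $ None) powi (k $ i) * h $ Some i + h $ None * ?c * z $ Some i)) (at z)"
      by simp
    then show "\<exists>D. ((\<lambda>w. (\<chi> i. (w $ None) powi (k $ i) * w $ Some i) $ i) has_derivative D) (at z) \<and>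
        (\<forall>c h. D (c *s h) = c * D h)"
      by (intro exI conjI) (assumption, simp add: algebra_simps)
  qed
  from holo_on_join[OF this] show ?thesis
    unfolding weighted_scale_def[abs_def] .
qed

lemma holo_on_imp_continuous_on: "holo_on f S \<Longrightarrow> continuous_on S f"
  unfolding holo_on_def
  by (meson continuous_at_imp_continuous_on has_derivative_continuous)

lemma open_nonzero_None: "open {w :: complex^('n::finite option). w $ None \<noteq> 0}"
  by (intro open_Collect_neq continuous_intros)

section \<open>The deformation space\<close>

locale weighted_chart =
  fixes X :: "('a, 'n::finite) charted_space" and U :: "'a set" and \<phi> :: "'a \<Rightarrow> complex^'n"
    and \<gamma> :: "nat^'n"
  assumes X: "complex_manifold X" and U: "openin (mtop X) U"
    and open_\<phi>U: "open (\<phi> ` U)" and zero: "0 \<in> \<phi> ` U"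
    and biholo_\<phi>: "biholo_map (open_submanifold X U) (open_subset_manifold (\<phi> ` U)) \<phi>"
    and \<gamma>: "\<And>i. \<gamma> $ i > 0"
begin

definition "\<Gamma> = (\<chi> i. int (\<gamma> $ i))"

abbreviation "\<Phi> \<equiv> phi_tilde \<gamma> \<phi>"
abbreviation "D \<equiv> U \<times> (- {0 :: complex})"
abbreviation "C \<equiv> U_tilde \<gamma> U \<phi>"

lemma U_sub: "U \<subseteq> points X"
  using U by (rule openin_subset)

lemma is_chart_X: "c \<in> charts X \<Longrightarrow> is_chart (mtop X) c"
  using X by (simp add: complex_manifold_def)

lemma inj_\<phi>: "inj_on \<phi> U"
proof -
  have "points (open_submanifold X U) = U"
    using U_sub by (auto simp: open_submanifold_def)
  then show ?thesis
    using biholo_\<phi> by (simp add: biholo_map_def bij_betw_def)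
qed

lemma holo_\<phi>: "holo_map (open_submanifold X U) (open_subset_manifold (\<phi> ` U)) \<phi>"
  and holo_inv_\<phi>: "holo_map (open_subset_manifold (\<phi> ` U)) (open_submanifold X U) (inv_into U \<phi>)"
proof -
  have "points (open_submanifold X U) = U"
    using U_sub by (auto simp: open_submanifold_def)
  then show "holo_map (open_submanifold X U) (open_subset_manifold (\<phi> ` U)) \<phi>"
    and "holo_map (open_subset_manifold (\<phi> ` U)) (open_submanifold X U) (inv_into U \<phi>)"
    using biholo_\<phi> by (simp_all add: biholo_map_def)
qed

lemma \<Phi>_eq: "\<Phi> (x, t) = weighted_scale (- \<Gamma>) (join (\<phi> x) t)"
  by (simp add: phi_tilde_def weighted_scale_def \<Gamma>_def)

lemma \<Phi>_None [simp]: "\<Phi> a $ None = snd a"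
  by (cases a) (simp add: \<Phi>_eq)

lemma scale_\<Phi>: "t \<noteq> 0 \<Longrightarrow> weighted_scale \<Gamma> (\<Phi> (x, t)) = join (\<phi> x) t"
  using weighted_scale_inverse[of "join (\<phi> x) t" "- \<Gamma>"] by (simp add: \<Phi>_eq)

lemma inj_\<Phi>: "inj_on \<Phi> D"
proof (rule inj_onI)
  fix a b assume ab: "a \<in> D" "b \<in> D" "\<Phi> a = \<Phi> b"
  then have "snd a \<noteq> 0" "snd b \<noteq> 0" by auto
  then have "weighted_scale \<Gamma> (\<Phi> a) = join (\<phi> (fst a)) (snd a)"
    "weighted_scale \<Gamma> (\<Phi> b) = join (\<phi> (fst b)) (snd b)"
    using scale_\<Phi>[of "snd a" "fst a"] scale_\<Phi>[of "snd b" "fst b"] by simp_all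
  with ab(3) have "join (\<phi> (fst a)) (snd a) = join (\<phi> (fst b)) (snd b)"
    by simp
  then show "a = b"
    using ab inj_\<phi> by (auto simp: prod_eq_iff dest: inj_onD)
qed

text \<open>Undoing the scaling: away from \<open>t = 0\<close> a point comes from \<open>U \<times> \<complex>\<^sup>*\<close> exactly if its rescaled
  first coordinates lie in \<open>\<phi> ` U\<close>.\<close>

lemma \<Phi>_image: "\<Phi> ` D = {w. w $ None \<noteq> 0 \<and> spatial (weighted_scale \<Gamma> w) \<in> \<phi> ` U}"
proof (intro subset_antisym subsetI)
  fix w assume "w \<in> \<Phi> ` D"
  then obtain x t where "x \<in> U" "t \<noteq> 0" "w = \<Phi> (x, t)" by auto
  then show "w \<in> {w. w $ None \<noteq> 0 \<and> spatial (weighted_scale \<Gamma> w) \<in> \<phi> ` U}"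
    by (simp add: scale_\<Phi>)
next
  fix w assume "w \<in> {w. w $ None \<noteq> 0 \<and> spatial (weighted_scale \<Gamma> w) \<in> \<phi> ` U}"
  then obtain x where x: "w $ None \<noteq> 0" "x \<in> U" "spatial (weighted_scale \<Gamma> w) = \<phi> x" by auto
  then have "join (\<phi> x) (w $ None) = weighted_scale \<Gamma> w"
    by (simp add: vec_option_eq_iff)
  then have "\<Phi> (x, w $ None) = w"
    using weighted_scale_inverse[OF x(1)] by (simp add: \<Phi>_eq)
  then show "w \<in> \<Phi> ` D"
    using x(1,2) by (intro image_eqI[of _ _ "(x, w $ None)"]) auto
qed

text \<open>The weights \<open>\<Gamma>\<close> are nonnegative, so the scaling is polynomial and continuous across \<open>t = 0\<close>.\<close>

lemma continuous_scale_\<Gamma>: "continuous_on UNIV (weighted_scale \<Gamma>)"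
  unfolding weighted_scale_def[abs_def] \<Gamma>_def by (simp, intro continuous_intros)

lemma open_scale_vimage: "open {w. spatial (weighted_scale \<Gamma> w) \<in> \<phi> ` U}"
proof -
  have "open ((\<lambda>w. spatial (weighted_scale \<Gamma> w)) -` (\<phi> ` U))"
    by (intro open_vimage open_\<phi>U continuous_on_spatial continuous_scale_\<Gamma>)
  then show ?thesis by (simp add: vimage_def)
qed

lemma open_\<Phi>_image: "open (\<Phi> ` D)"
  unfolding \<Phi>_image by (intro open_Collect_conj open_nonzero_None open_scale_vimage)

text \<open>At \<open>t = 0\<close> the weights are positive, so the scaled point has first coordinates \<open>0 \<in> \<phi> ` U\<close>
  and the first condition holds automatically.  This describes the set by two open conditions on
  all of \<open>\<complex>\<^sup>n\<^sup>+\<^sup>1\<close>, which makes \<open>U_tilde\<close> open also at its points with \<open>t = 0\<close>.\<close>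

lemma C_eq: "C = {w. spatial (weighted_scale \<Gamma> w) \<in> \<phi> ` U} \<inter>
    ({w. w $ None \<noteq> 0} \<union> {w. \<forall>i. w $ Some i \<noteq> 0})"
proof -
  have "{join z 0 | z. \<forall>i. z $ i \<noteq> 0} = {w :: complex^('n option). w $ None = 0 \<and> (\<forall>i. w $ Some i \<noteq> 0)}"
  proof (intro subset_antisym subsetI)
    fix w :: "complex^('n option)" assume "w \<in> {w. w $ None = 0 \<and> (\<forall>i. w $ Some i \<noteq> 0)}"
    then show "w \<in> {join z 0 | z. \<forall>i. z $ i \<noteq> 0}"
      by (auto simp: vec_option_eq_iff intro!: exI[of _ "spatial w"])
  qed auto
  moreover have "spatial (weighted_scale \<Gamma> w) = 0" if "w $ None = 0" for w
  proof -
    have "\<gamma> $ i \<noteq> 0" for i using \<gamma>[of i] by simp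
    then show ?thesis
      using that by (simp add: vec_eq_iff weighted_scale_def \<Gamma>_def power_int_0_left_if)
  qed
  ultimately show ?thesis
    unfolding U_tilde_def \<Phi>_image using zero by auto
qed

lemma open_C: "open C"
proof -
  have "open (\<Inter>i. {w :: complex^('n option). w $ Some i \<noteq> 0})"
    by (intro open_INT ballI open_Collect_neq continuous_intros) simp
  then have "open {w :: complex^('n option). \<forall>i. w $ Some i \<noteq> 0}"
    by (simp add: Collect_all_eq)
  then show ?thesis
    unfolding C_eq by (intro open_Int open_Un open_scale_vimage open_nonzero_None)
qed

lemma \<Phi>_image_sub: "\<Phi> ` D \<subseteq> C"
  by (auto simp: U_tilde_def)


abbreviation "MD \<equiv> open_submanifold (times_Cstar X) D"
abbreviation "ND \<equiv> open_submanifold (open_subset_manifold C) (\<Phi> ` D)"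

lemma openin_D: "openin (mtop (times_Cstar X)) D"
  using U by (simp add: times_Cstar_def openin_prod_Times_iff)

lemma openin_\<Phi>_image: "openin (top_of_set C) (\<Phi> ` D)"
  using open_\<Phi>_image \<Phi>_image_sub by (metis open_openin openin_subset_topspace_eq open_subset)

lemma mtop_MD: "mtop MD = prod_topology (subtopology (mtop X) U) (top_of_set (- {0}))"
  by (simp add: open_submanifold_def times_Cstar_def subtopology_Times subtopology_subtopology)

lemma mtop_ND: "mtop ND = top_of_set (\<Phi> ` D)"
  using \<Phi>_image_sub
  by (simp add: open_submanifold_def open_subset_manifold_def subtopology_subtopology inf.absorb2)

lemma points_MD: "points MD = D"
  using U_sub unfolding mtop_MD by auto

lemma points_ND: "points ND = \<Phi> ` D"
  by (simp add: mtop_ND)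

lemma charts_MD: "charts MD = (\<lambda>(V, \<psi>). ((V \<inter> U) \<times> - {0}, \<lambda>(x, t). join (\<psi> x) t)) ` charts X"
proof -
  have "(V \<times> - {0}) \<inter> D = (V \<inter> U) \<times> - {0}" for V by auto
  then show ?thesis
    by (simp add: open_submanifold_def times_Cstar_def image_image case_prod_unfold)
qed

lemma charts_ND: "charts ND = {(\<Phi> ` D, id)}"
  using \<Phi>_image_sub by (simp add: open_submanifold_def open_subset_manifold_def inf.absorb2)

lemma is_chart_MD: "c \<in> charts MD \<Longrightarrow> is_chart (mtop MD) c"
proof -
  assume "c \<in> charts MD"
  then obtain V \<psi> where c: "(V, \<psi>) \<in> charts X" "c = ((V \<inter> U) \<times> - {0}, \<lambda>(x, t). join (\<psi> x) t)"
    unfolding charts_MD by auto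
  then have "is_chart (subtopology (mtop X) U) (V \<inter> U, \<psi>)"
    using U by (intro is_chart_restrict is_chart_X)
  then show ?thesis
    unfolding c(2) mtop_MD by (rule is_chart_times_Cstar)
qed

lemma is_chart_ND: "c \<in> charts ND \<Longrightarrow> is_chart (mtop ND) c"
  by (simp add: charts_ND mtop_ND is_chart_id open_\<Phi>_image)

lemma continuous_\<phi>: "continuous_map (subtopology (mtop X) U) euclidean \<phi>"
  using holo_\<phi>
  by (simp add: holo_map_def open_submanifold_def open_subset_manifold_def continuous_map_in_subtopology)

lemma continuous_inv_\<phi>: "continuous_map (top_of_set (\<phi> ` U)) (subtopology (mtop X) U) (inv_into U \<phi>)"
  using holo_inv_\<phi> by (simp add: holo_map_def open_submanifold_def open_subset_manifold_def)

lemma holo_chart_\<phi>: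
  assumes "(V, \<psi>) \<in> charts X"
  shows "holo_on (\<phi> \<circ> inv_into (V \<inter> U) \<psi>) (\<psi> ` (V \<inter> U))"
proof -
  have "(V \<inter> U, \<psi>) \<in> charts (open_submanifold X U)" "(\<phi> ` U, id) \<in> charts (open_subset_manifold (\<phi> ` U))"
    using assms by (force simp: open_submanifold_def open_subset_manifold_def)+
  then have "holo_on (id \<circ> \<phi> \<circ> inv_into (V \<inter> U) \<psi>) (\<psi> ` ((V \<inter> U) \<inter> \<phi> -` (\<phi> ` U)))"
    using holo_\<phi> unfolding holo_map_def by fast
  moreover have "(V \<inter> U) \<inter> \<phi> -` (\<phi> ` U) = V \<inter> U" by auto
  ultimately show ?thesis by simp
qed

lemma holo_chart_inv_\<phi>:
  assumes "(V, \<psi>) \<in> charts X"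
  shows "holo_on (\<psi> \<circ> inv_into U \<phi> \<circ> inv_into (\<phi> ` U) id) (\<phi> ` (V \<inter> U))"
proof -
  have "(V \<inter> U, \<psi>) \<in> charts (open_submanifold X U)" "(\<phi> ` U, id) \<in> charts (open_subset_manifold (\<phi> ` U))"
    using assms by (force simp: open_submanifold_def open_subset_manifold_def)+
  then have "holo_on (\<psi> \<circ> inv_into U \<phi> \<circ> inv_into (\<phi> ` U) id)
      (id ` (\<phi> ` U \<inter> inv_into U \<phi> -` (V \<inter> U)))"
    using holo_inv_\<phi> unfolding holo_map_def by fast
  moreover have "\<phi> ` U \<inter> inv_into U \<phi> -` (V \<inter> U) = \<phi> ` (V \<inter> U)"
    using inj_\<phi> by auto
  ultimately show ?thesis by simp
qed

text \<open>In a chart \<open>\<psi>\<close> of \<open>X\<close>, the map is \<open>\<phi> \<circ> \<psi>\<^sup>-\<^sup>1\<close> on the first \<open>n\<close> coordinates followed by the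
  scaling with weights \<open>-\<gamma>\<close>.\<close>

lemma holo_\<Phi>: "holo_map MD ND \<Phi>"
proof (rule holo_mapI[OF is_chart_MD])
  show "openin (mtop ND) W" if "(W, \<theta>) \<in> charts ND" for W \<theta>
    using is_chart_ND[OF that] by (simp add: is_chart_iff)
  show "continuous_map (mtop MD) (mtop ND) \<Phi>"
  proof -
    have "continuous_map (mtop MD) (prod_topology euclidean (top_of_set (- {0}))) (\<lambda>(x, t). (\<phi> x, t))"
      unfolding mtop_MD continuous_map_prod_top using continuous_\<phi> by simp
    moreover have "continuous_map (prod_topology euclidean (top_of_set (- {0}))) euclidean
        (\<lambda>(z, t). weighted_scale (- \<Gamma>) (join z t))"
    proof -
      have "prod_topology euclidean (top_of_set (- {0})) =
          top_of_set (UNIV \<times> - {0} :: ((complex^'n) \<times> complex) set)"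
        by (metis prod_topology_euclidean subtopology_Times subtopology_UNIV)
      moreover have "continuous_on (UNIV \<times> - {0}) (\<lambda>p :: (complex^'n) \<times> complex.
          weighted_scale (- \<Gamma>) (join (fst p) (snd p)))"
        by (rule continuous_on_compose2[OF holo_on_imp_continuous_on[OF holo_on_weighted_scale]])
          (auto intro!: continuous_intros)
      ultimately show ?thesis
        by (simp add: case_prod_unfold)
    qed
    ultimately have "continuous_map (mtop MD) euclidean
        ((\<lambda>(z, t). weighted_scale (- \<Gamma>) (join z t)) \<circ> (\<lambda>(x, t). (\<phi> x, t)))"
      by (rule continuous_map_compose)
    moreover have "(\<lambda>(z, t). weighted_scale (- \<Gamma>) (join z t)) \<circ> (\<lambda>(x, t). (\<phi> x, t)) = \<Phi>"
      by (simp add: fun_eq_iff \<Phi>_eq)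
    ultimately show ?thesis
      unfolding mtop_ND continuous_map_in_subtopology points_MD by simp
  qed
next
  fix V' \<psi>' W \<theta> assume "(V', \<psi>') \<in> charts MD" and d: "(W, \<theta>) \<in> charts ND"
  then obtain V \<psi> where c: "(V, \<psi>) \<in> charts X"
      "V' = (V \<inter> U) \<times> - {0}" "\<psi>' = (\<lambda>(x, t). join (\<psi> x) t)"
    unfolding charts_MD by auto
  have d: "W = \<Phi> ` D" "\<theta> = id" using d by (auto simp: charts_ND)
  have set: "V' \<inter> \<Phi> -` W = (V \<inter> U) \<times> - {0}" unfolding c(2) d by auto
  have inj: "inj_on \<psi> (V \<inter> U)"
    using is_chart_X[OF c(1)] by (auto simp: is_chart_iff intro: inj_on_subset)
  let ?h = "weighted_scale (- \<Gamma>) \<circ>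
    (\<lambda>w. join (((\<phi> \<circ> inv_into (V \<inter> U) \<psi>) \<circ> spatial) w) (w $ None))"
  have "holo_on ?h (\<psi>' ` ((V \<inter> U) \<times> - {0}))"
    by (rule holo_on_compose[OF holo_on_join[OF holo_on_compose[OF holo_on_spatial holo_chart_\<phi>[OF c(1)]]]
          holo_on_weighted_scale])
      (auto simp: c(3))
  moreover have "?h (\<psi>' v) = \<theta> (\<Phi> v)" if "v \<in> (V \<inter> U) \<times> - {0}" for v
    using that inj by (auto simp: c(3) d \<Phi>_eq)
  ultimately show "\<exists>h. holo_on h (\<psi>' ` (V' \<inter> \<Phi> -` W)) \<and> (\<forall>v \<in> V' \<inter> \<Phi> -` W. h (\<psi>' v) = \<theta> (\<Phi> v))"
    unfolding set by blast
qed

lemma inv_\<Phi>: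
  assumes "w \<in> \<Phi> ` D"
  shows "inv_into D \<Phi> w = (inv_into U \<phi> (spatial (weighted_scale \<Gamma> w)), w $ None)"
proof -
  obtain x t where "x \<in> U" "t \<noteq> 0" "w = \<Phi> (x, t)" using assms by auto
  then show ?thesis
    using inj_\<phi> inj_\<Phi> by (simp add: scale_\<Phi>)
qed

text \<open>The inverse scales with weights \<open>\<gamma>\<close> and then applies \<open>\<phi>\<^sup>-\<^sup>1\<close> to the first \<open>n\<close> coordinates.\<close>

lemma holo_inv_\<Phi>: "holo_map ND MD (inv_into D \<Phi>)"
proof (rule holo_mapI[OF is_chart_ND])
  show "openin (mtop MD) W" if "(W, \<theta>) \<in> charts MD" for W \<theta>
    using is_chart_MD[OF that] by (simp add: is_chart_iff)
  have sub: "(\<lambda>w. spatial (weighted_scale \<Gamma> w)) ` \<Phi> ` D \<subseteq> \<phi> ` U" "(\<lambda>w. w $ None) ` \<Phi> ` D \<subseteq> - {0}"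
    unfolding \<Phi>_image by auto
  show "continuous_map (mtop ND) (mtop MD) (inv_into D \<Phi>)"
  proof (rule continuous_map_eq)
    have "continuous_map (top_of_set (\<Phi> ` D)) (top_of_set (\<phi> ` U)) (\<lambda>w. spatial (weighted_scale \<Gamma> w))"
      using sub(1) continuous_on_subset[OF continuous_scale_\<Gamma>]
      by (auto intro!: continuous_on_spatial simp: image_subset_iff_funcset)
    from continuous_map_compose[OF this continuous_inv_\<phi>]
    have "continuous_map (top_of_set (\<Phi> ` D)) (subtopology (mtop X) U)
        (\<lambda>w. inv_into U \<phi> (spatial (weighted_scale \<Gamma> w)))"
      by (simp add: comp_def)
    moreover have "continuous_map (top_of_set (\<Phi> ` D)) (top_of_set (- {0})) (\<lambda>w. w $ None)"
      using sub(2) by (auto intro!: continuous_intros simp: image_subset_iff_funcset)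
    ultimately show "continuous_map (mtop ND) (mtop MD)
        (\<lambda>w. (inv_into U \<phi> (spatial (weighted_scale \<Gamma> w)), w $ None))"
      unfolding mtop_MD mtop_ND by (rule continuous_map_pairedI)
  qed (simp add: points_ND inv_\<Phi>)
next
  fix V' \<psi>' W \<theta> assume d: "(W, \<theta>) \<in> charts ND" and "(V', \<psi>') \<in> charts MD"
  then obtain V \<psi> where c: "(V, \<psi>) \<in> charts X"
      "V' = (V \<inter> U) \<times> - {0}" "\<psi>' = (\<lambda>(x, t). join (\<psi> x) t)"
    unfolding charts_MD by auto
  have d: "W = \<Phi> ` D" "\<theta> = id" using d by (auto simp: charts_ND)
  let ?S = "W \<inter> inv_into D \<Phi> -` V'"
  let ?k = "\<psi> \<circ> inv_into U \<phi> \<circ> inv_into (\<phi> ` U) id"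
  let ?h = "\<lambda>w. join ((?k \<circ> (spatial \<circ> weighted_scale \<Gamma>)) w) (w $ None)"
  have S: "w $ None \<noteq> 0 \<and> (\<exists>x \<in> V \<inter> U. spatial (weighted_scale \<Gamma> w) = \<phi> x \<and> inv_into D \<Phi> w = (x, w $ None))"
    if w: "w \<in> ?S" for w
  proof -
    have "w \<in> \<Phi> ` D" using w d by blast
    then obtain x t where x: "x \<in> U" "t \<noteq> 0" "w = \<Phi> (x, t)" by auto
    then have inv: "inv_into D \<Phi> w = (x, t)" using inj_\<Phi> by simp
    then have "x \<in> V" using w c(2) by auto
    then show ?thesis using x inv by (auto simp: scale_\<Phi>)
  qed
  have "holo_on (spatial \<circ> weighted_scale \<Gamma>) ?S"
    by (rule holo_on_compose[OF holo_on_subset[OF holo_on_weighted_scale] holo_on_spatial[of UNIV]])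
      (use S in auto)
  then have "holo_on (?k \<circ> (spatial \<circ> weighted_scale \<Gamma>)) ?S"
    by (rule holo_on_compose[OF _ holo_chart_inv_\<phi>[OF c(1)]]) (use S in force)
  then have "holo_on ?h ?S" by (rule holo_on_join)
  moreover have "?h w = \<psi>' (inv_into D \<Phi> w)" if w: "w \<in> ?S" for w
  proof -
    obtain x where x: "x \<in> V \<inter> U" "spatial (weighted_scale \<Gamma> w) = \<phi> x" "inv_into D \<Phi> w = (x, w $ None)"
      using S[OF w] by blast
    moreover have "inv_into (\<phi> ` U) id (\<phi> x) = \<phi> x"
      using x(1) inv_into_f_f[of id "\<phi> ` U" "\<phi> x"] by simp
    ultimately show ?thesis
      using inj_\<phi> by (simp add: c(3))
  qed
  ultimately show "\<exists>h. holo_on h (\<theta> ` ?S) \<and> (\<forall>v \<in> ?S. h (\<theta> v) = \<psi>' (inv_into D \<Phi> v))"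
    unfolding d(2) by (intro exI[of _ ?h]) simp
qed

lemma biholo_\<Phi>: "biholo_map MD ND \<Phi>"
  unfolding biholo_map_def points_MD points_ND
  using inj_\<Phi> holo_\<Phi> holo_inv_\<Phi> by (simp add: bij_betw_def)

sublocale deformation: gluing "times_Cstar X" "open_subset_manifold C" D \<Phi>
proof
  show "complex_manifold (times_Cstar X)"
    by (rule complex_manifold_times_Cstar[OF X])
  show "complex_manifold (open_subset_manifold C)"
    by (rule complex_manifold_open_subset[OF open_C])
  show "openin (mtop (times_Cstar X)) D" by (rule openin_D)
  show "openin (mtop (open_subset_manifold C)) (\<Phi> ` D)"
    using openin_\<Phi>_image by (simp add: open_subset_manifold_def)
  show "biholo_map MD ND \<Phi>" by (rule biholo_\<Phi>)
next
  fix a b assume a: "a \<in> points (times_Cstar X) - D"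
    and b: "b \<in> points (open_subset_manifold C) - \<Phi> ` D"
  then have t: "snd a \<noteq> 0" "b $ None = 0" "b \<in> C" "a \<in> points X \<times> - {0}"
    by (auto simp: times_Cstar_def open_subset_manifold_def U_tilde_def)
  \<comment> \<open>The map preserves \<open>t\<close>, which is nonzero at \<open>a\<close> and zero at \<open>b\<close>; half its modulus at \<open>a\<close> is a threshold.\<close>
  let ?e = "norm (snd a) / 2"
  let ?P = "points X \<times> {t. norm t > ?e}" and ?Q = "C \<inter> {w. norm (w $ None) < ?e}"
  have "openin (top_of_set (- {0})) {t :: complex. norm t > ?e}"
    by (rule open_subset) (auto intro!: open_Collect_less continuous_intros)
  then have "openin (mtop (times_Cstar X)) ?P"
    by (simp add: times_Cstar_def openin_prod_Times_iff)
  moreover have "openin (mtop (open_subset_manifold C)) ?Q"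
    unfolding open_subset_manifold_def charted_space.simps
    by (intro openin_open_Int open_Collect_less continuous_intros)
  moreover have "a \<in> ?P" "b \<in> ?Q" "\<Phi> ` (?P \<inter> D) \<inter> ?Q = {}"
    using t by auto
  ultimately show "\<exists>P Q. openin (mtop (times_Cstar X)) P \<and> openin (mtop (open_subset_manifold C)) Q \<and>
      a \<in> P \<and> b \<in> Q \<and> \<Phi> ` (P \<inter> D) \<inter> Q = {}"
    by (intro exI[of _ ?P] exI[of _ ?Q] conjI)
qed

lemma deformation_eq: "deformation X \<gamma> U \<phi> = deformation.G"
  by (simp add: deformation_def)

lemma pi_i: "a \<in> points (times_Cstar X) \<Longrightarrow> deformation_pi (deformation.i a) = snd a"
proof -
  assume "a \<in> points (times_Cstar X)"
  then have "case_sum snd (\<lambda>w. w $ None) ` deformation.i a = {snd a}"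
    by (auto simp: deformation.i_eq)
  then show ?thesis by (simp add: deformation_pi_def)
qed

lemma pi_j: "b \<in> points (open_subset_manifold C) \<Longrightarrow> deformation_pi (deformation.j b) = b $ None"
proof -
  assume "b \<in> points (open_subset_manifold C)"
  then have "case_sum snd (\<lambda>w. w $ None) ` deformation.j b = {b $ None}"
    by (auto simp: deformation.j_eq)
  then show ?thesis by (simp add: deformation_pi_def)
qed

lemma continuous_pi: "continuous_map (mtop deformation.G) euclidean deformation_pi"
proof (rule deformation.continuous_map_glue)
  have "continuous_map (mtop (times_Cstar X)) (top_of_set (- {0})) snd"
    unfolding times_Cstar_def by (simp add: continuous_map_snd)
  then have "continuous_map (mtop (times_Cstar X)) euclidean snd"
    by (simp add: continuous_map_in_subtopology)
  then show "continuous_map (mtop (times_Cstar X)) euclidean (\<lambda>a. deformation_pi (deformation.i a))"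
    by (rule continuous_map_eq) (simp add: pi_i)
  have "continuous_map (mtop (open_subset_manifold C)) euclidean (\<lambda>w. w $ None)"
    by (simp add: open_subset_manifold_def) (intro continuous_intros)
  then show "continuous_map (mtop (open_subset_manifold C)) euclidean (\<lambda>b. deformation_pi (deformation.j b))"
    by (rule continuous_map_eq) (simp add: pi_j)
qed

text \<open>The charts of \<open>X \<times> \<complex>\<^sup>*\<close> and of \<open>U_tilde\<close> both have \<open>t\<close> as last coordinate.\<close>

lemma pi_in_charts:
  assumes "(V, \<psi>) \<in> charts deformation.G" "v \<in> V"
  shows "deformation_pi v = \<psi> v $ None"
  using assms(1) unfolding deformation.charts_glue
proof (elim UnE imageE)
  fix c assume c: "(V, \<psi>) = push_chart (points (times_Cstar X)) deformation.i c" "c \<in> charts (times_Cstar X)"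
  obtain W \<theta> where W: "c = (W, \<theta>)" by (cases c)
  have sub: "W \<subseteq> points (times_Cstar X)" using deformation.chart_M' c(2) W by blast
  obtain w where w: "w \<in> W" "v = deformation.i w"
    using assms(2) c(1) W by (auto simp: push_chart_def)
  have wM: "w \<in> points (times_Cstar X)" using w(1) sub by blast
  have "\<psi> v = \<theta> w"
    using c(1) W inv_into_f_f[OF deformation.inj_i wM] by (simp add: push_chart_def w(2))
  moreover have "\<theta> w $ None = snd w"
    using c(2) W by (cases w) (auto simp: times_Cstar_def)
  ultimately show ?thesis using pi_i[OF wM] w(2) by simp
next
  fix c assume c: "(V, \<psi>) = push_chart (points (open_subset_manifold C)) deformation.j c"
    "c \<in> charts (open_subset_manifold C)"
  have W: "c = (C, id)" using c(2) by (simp add: open_subset_manifold_def)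
  obtain w where w: "w \<in> C" "v = deformation.j w"
    using assms(2) c(1) W by (auto simp: push_chart_def)
  have wN: "w \<in> points (open_subset_manifold C)" using w(1) by (simp add: open_subset_manifold_def)
  have "\<psi> v = w"
    using c(1) W inv_into_f_f[OF deformation.inj_j wN] by (simp add: push_chart_def w(2))
  then show ?thesis using pi_j[OF wN] w(2) by simp
qed

lemma holo_pi: "holo_map deformation.G complex_plane deformation_pi"
proof (rule holo_mapI[OF deformation.is_chart_glue])
  show "continuous_map (mtop deformation.G) (mtop complex_plane) deformation_pi"
    using continuous_pi by (simp add: complex_plane_def)
  show "openin (mtop complex_plane) W" if "(W, \<theta>) \<in> charts complex_plane" for W \<theta>
    using that by (simp add: complex_plane_def)
  fix V \<psi> W and \<theta> :: "complex \<Rightarrow> complex^1"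
  assume c: "(V, \<psi>) \<in> charts deformation.G" and "(W, \<theta>) \<in> charts complex_plane"
  then have d: "W = UNIV" "\<theta> = vec" by (auto simp: complex_plane_def)
  have "Vector_Spaces.linear (*s) (*s) (\<lambda>h :: complex^('n option). vec (h $ None) :: complex^1)"
    by (rule linear_vecI) (simp_all add: vec_eq_iff)
  then have "holo_on (\<lambda>w. vec (w $ None) :: complex^1) (\<psi> ` (V \<inter> deformation_pi -` W))"
    unfolding holo_on_def using vec_None_has_derivative by blast
  then show "\<exists>h. holo_on h (\<psi> ` (V \<inter> deformation_pi -` W)) \<and>
      (\<forall>v \<in> V \<inter> deformation_pi -` W. h (\<psi> v) = \<theta> (deformation_pi v))"
    by (intro exI conjI) (assumption, simp add: d pi_in_charts[OF c])
qed

text \<open>In a chart \<open>\<pi>\<close> is the projection to the last coordinate, and its derivative is unique since the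
  image of the chart is open.\<close>

lemma no_critical_point: "\<not> critical_point deformation.G complex_plane deformation_pi x"
proof
  assume "critical_point deformation.G complex_plane deformation_pi x"
  then obtain V \<psi> W \<theta> D' where c: "(V, \<psi>) \<in> charts deformation.G" and "(W, \<theta>) \<in> charts complex_plane"
    and x: "x \<in> V" and D': "((\<theta> \<circ> deformation_pi \<circ> inv_into V \<psi>) has_derivative D') (at (\<psi> x))"
    and nsurj: "\<not> surj D'"
    unfolding critical_point_def by blast
  then have d: "\<theta> = vec" by (auto simp: complex_plane_def)
  have chart: "is_chart (mtop deformation.G) (V, \<psi>)" by (rule deformation.is_chart_glue[OF c])
  then have inj: "inj_on \<psi> V" and V: "openin (mtop deformation.G) V" by (auto simp: is_chart_iff)
  have op: "open (\<psi> ` V)" using is_chart_image_open[OF chart V] by simp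
  have "((\<theta> \<circ> deformation_pi \<circ> inv_into V \<psi>) has_derivative (\<lambda>h. vec (h $ None))) (at (\<psi> x))"
    by (rule has_derivative_transform_within_open[OF vec_None_has_derivative op])
      (use x inj in \<open>auto simp: d pi_in_charts[OF c]\<close>)
  then have "D' = (\<lambda>h. vec (h $ None))"
    by (rule has_derivative_unique[OF D'])
  moreover have "surj (\<lambda>h :: complex^('n option). vec (h $ None) :: complex^1)"
  proof (rule surjI)
    fix y :: "complex^1"
    show "vec (join 0 (y $ 1) $ None) = y" by (simp add: vec_eq_iff)
  qed
  ultimately show False using nsurj by simp
qed

end

theorem proposition3p3:
  fixes X :: "('a, 'n::finite) charted_space"
    and p :: 'a
    and U :: "'a set"
    and \<phi> :: "'a \<Rightarrow> complex^'n"
    and \<gamma> :: "nat^'n"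
  assumes "complex_manifold X"
    and "p \<in> points X"
    and "openin (mtop X) U" and "p \<in> U"
    and "open (\<phi> ` U)"
    and "biholo_map (open_submanifold X U) (open_subset_manifold (\<phi> ` U)) \<phi>"
    and "\<phi> p = 0"
    and "\<forall>i. \<gamma> $ i > 0"
  shows "complex_manifold (deformation X \<gamma> U \<phi>) \<and>
    holo_map (deformation X \<gamma> U \<phi>) complex_plane deformation_pi \<and>
    \<not> (\<exists>x. critical_point (deformation X \<gamma> U \<phi>) complex_plane deformation_pi x)"
proof -
  interpret weighted_chart X U \<phi> \<gamma>
  proof
    show "0 \<in> \<phi> ` U" using assms(4,7) by force
  qed (use assms in auto)
  show ?thesis
    unfolding deformation_eq
    using deformation.complex_manifold_glue holo_pi no_critical_point by blast
qed

end
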